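(* Let $t\ge 2$ and let $\Pi=\{\pi_i\}_{i\in\mathbb{Z}}$ be an even-near-critical centrally symmetric allowable sequence of $2n$ points in noncentral general position with central signature $(d_1,d_2,\dots,d_t)$, and assume that the first move (from $\pi_0$ to $\pi_1$) contains a crossing switch. Let $\delta_1=0$, $\delta_2=d_1+d_2$, and for $3\le i\le t$ let $\delta_i=d_1+2d_2+\dots+2d_{i-1}+d_i$, so that the crossing substring $s_i$ is reversed from $\pi_{\delta_i}$ to $\pi_{\delta_i+1}$. Then for $1\le i\le t$ and $1\le k\le d_i$, $$\gamma(s_i(k))=\begin{cases} \mathrm{R}^{\delta_i-k+1}\,\mathrm{P}^{k-1}\,\mathrm{C}\,\mathrm{P}^{k-1}\,\mathrm{R}^{n-d_i}\,\mathrm{P}^{2(d_i-k)+1}\,\mathrm{L}^{n-d_i-\delta_i+k-1} & \text{if } d_i-k<n-\delta_i,\\ \mathrm{P}^{d_i-k+\delta_i-n+1}\,\mathrm{R}^{n-d_i}\,\mathrm{P}^{k-1}\,\mathrm{C}\,\mathrm{P}^{k-1}\,\mathrm{R}^{n-d_i}\,\mathrm{P}^{d_i-k-\delta_i+n} & \text{if } d_i-k\ge|\delta_i-n|,\\ \mathrm{L}^{\delta_i-n-d_i+k}\,\mathrm{P}^{2(d_i-k)+1}\,\mathrm{R}^{n-d_i}\,\mathrm{P}^{k-1}\,\mathrm{C}\,\mathrm{P}^{k-1}\,\mathrm{R}^{2n-\delta_i-k} & \text{if } d_i-k<\delta_i-n, \end{cases}$$ where $X^m$ denotes the letter $X$ repeated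 $m$ times.
   Context: An allowable sequence on a finite set of $N$ points is a doubly infinite sequence $\Pi=\{\pi_i\}_{i\in\mathbb{Z}}$ of permutations (linear orderings) of the points such that: (i) there is a positive integer $h=h(\Pi)$ such that $\pi_{i+h}$ is the reversal of $\pi_i$ for all $i$ (then $\pi_0,\dots,\pi_h$ is called a halfperiod, of length $h$); (ii) $\pi_i$ is obtained from $\pi_{i-1}$ by reversing one or more disjoint substrings of consecutive elements; these reversals are called switches, and the set of switches from $\pi_{i-1}$ to $\pi_i$ is the $i$-th move; (iii) any pair of points participates together in a switch exactly once within a halfperiod. A switch of two points is a transposition. Write $\pi(p)$ for the position of the point $p$ in $\pi$. An allowable sequence with $2n$ points is centrally symmetric if for every point $p$ there is a point $\overline p$ (its conjugate) with $\pi(p)+\pi(\overline p)=2n+1$ for every permutation $\pi$ of the sequence. A crossing switch is a switch reversing a centered substring of a permutation. The sequence is in noncentral general position if all switches except possibly crossing switches are transpositions. It is even-near-critical if $h(\Pi)=2n$. Its central signature is $(d_1,\dots,d_t)$, where $2d_i$ is the number of points reversed by the $i$-th crossing switch in the halfperiod $\pi_0,\pi_1,\dots,\pi_h$. The substring $s_i=(s_i(1),\dots,s_i(2d_i))$ reversed by the $i$-th crossing switch, read just before it is reversed, is called the $i$-th crossing substring; $\overline{s_i(k)}=s_i(2d_i+1-k)$. (For these sequences $n=d_1+\dots+d_t$.) The path $\gamma(p)$ of a point $p$ is the word of length $2n$ in the letters C, P, R, L whose $i$-th letter ($1\le i\le 2n$) is: C if $p$ participates in a crossing switch from $\pi_{i-1}$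 to $\pi_i$; P if $p$ participates in no switch from $\pi_{i-1}$ to $\pi_i$; R (resp. L) if (through a non-crossing switch) the position of $p$ in $\pi_i$ is to the right (resp. left) of its position in $\pi_{i-1}$.
   Formalization: For i = 1 and k ≥ 2 the first case has the negative exponent δ_1−k+1 = 1−k and is undefined; there the formal statement instead gives γ(s_1(k)) = C P^{k−1} R^{n−d_1} P^{2(d_1−k)+1} L^{n−d_1} P^{k−1}. All other cases are as stated. *)

theory Defs
  imports Main
begin

text \<open>
  A permutation of the finite point set \<open>A\<close> is given by its position function
  \<open>\<sigma>\<close>, a bijection from \<open>A\<close> onto \<open>{1..card A}\<close>; values outside \<open>A\<close> are irrelevant.
  A substring of consecutive elements is given by the pair \<open>(a, b)\<close> of its first and last
  position.
\<close>

definition is_permutation :: "'a set \<Rightarrow> ('a \<Rightarrow> nat) \<Rightarrow> bool" where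
  "is_permutation A \<sigma> \<longleftrightarrow> bij_betw \<sigma> A {1..card A}"

definition in_substring :: "('a \<Rightarrow> nat) \<Rightarrow> nat \<times> nat \<Rightarrow> 'a \<Rightarrow> bool" where
  "in_substring \<sigma> I p \<longleftrightarrow> fst I \<le> \<sigma> p \<and> \<sigma> p \<le> snd I"

definition is_move :: "'a set \<Rightarrow> ('a \<Rightarrow> nat) \<Rightarrow> ('a \<Rightarrow> nat) \<Rightarrow> (nat \<times> nat) set \<Rightarrow> bool" where
  "is_move A \<sigma> \<tau> B \<longleftrightarrow>
     B \<noteq> {} \<and>
     (\<forall>(a, b)\<in>B. 1 \<le> a \<and> a < b \<and> b \<le> card A) \<and>
     (\<forall>(a, b)\<in>B. \<forall>(a', b')\<in>B. (a, b) \<noteq> (a', b') \<longrightarrow> {a..b} \<inter> {a'..b'} = {}) \<and>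
     (\<forall>p\<in>A. (\<forall>(a, b)\<in>B. in_substring \<sigma> (a, b) p \<longrightarrow> \<tau> p + \<sigma> p = a + b) \<and>
            ((\<forall>I\<in>B. \<not> in_substring \<sigma> I p) \<longrightarrow> \<tau> p = \<sigma> p))"

text \<open>
  The set of switches of a move is determined by the two permutations: a substring
  \<open>(a, b)\<close> is reversed only if positions \<open>a\<close> and \<open>b\<close> are exchanged, so two sets of
  disjoint substrings of length at least 2 with the same effect coincide.
  Thus \<open>is_switch A \<pi> i I\<close> says that \<open>I\<close> is reversed between \<open>\<pi> (i - 1)\<close> and \<open>\<pi> i\<close>.
\<close>

definition is_switch :: "'a set \<Rightarrow> (int \<Rightarrow> 'a \<Rightarrow> nat) \<Rightarrow> int \<Rightarrow> nat \<times> nat \<Rightarrow> bool" where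
  "is_switch A \<pi> i I \<longleftrightarrow> (\<exists>B. is_move A (\<pi> (i - 1)) (\<pi> i) B \<and> I \<in> B)"

text \<open>
  The parameter \<open>h\<close> is the length of a halfperiod; it is determined by the sequence
  as soon as there are at least two points.
\<close>

definition allowable_sequence :: "'a set \<Rightarrow> (int \<Rightarrow> 'a \<Rightarrow> nat) \<Rightarrow> nat \<Rightarrow> bool" where
  "allowable_sequence A \<pi> h \<longleftrightarrow>
     finite A \<and> (\<forall>i. is_permutation A (\<pi> i)) \<and>
     0 < h \<and> (\<forall>i. \<forall>p\<in>A. \<pi> (i + int h) p + \<pi> i p = card A + 1) \<and>
     (\<forall>i. \<exists>B. is_move A (\<pi> (i - 1)) (\<pi> i) B) \<and>
     (\<forall>p\<in>A. \<forall>q\<in>A. p \<noteq> q \<longrightarrow>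
        (\<exists>!i. i \<in> {1..int h} \<and>
           (\<exists>I. is_switch A \<pi> i I \<and> in_substring (\<pi> (i - 1)) I p \<and> in_substring (\<pi> (i - 1)) I q)))"

definition centrally_symmetric :: "'a set \<Rightarrow> (int \<Rightarrow> 'a \<Rightarrow> nat) \<Rightarrow> bool" where
  "centrally_symmetric A \<pi> \<longleftrightarrow>
     (\<forall>p\<in>A. \<exists>q\<in>A. \<forall>i. \<pi> i p + \<pi> i q = card A + 1)"

definition crossing_switch :: "'a set \<Rightarrow> (int \<Rightarrow> 'a \<Rightarrow> nat) \<Rightarrow> int \<Rightarrow> nat \<times> nat \<Rightarrow> bool" where
  "crossing_switch A \<pi> i I \<longleftrightarrow> is_switch A \<pi> i I \<and> fst I + snd I = card A + 1"

definition noncentral_general_position :: "'a set \<Rightarrow> (int \<Rightarrow> 'a \<Rightarrow> nat) \<Rightarrow> bool" where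
  "noncentral_general_position A \<pi> \<longleftrightarrow>
     (\<forall>i I. is_switch A \<pi> i I \<and> \<not> crossing_switch A \<pi> i I \<longrightarrow> snd I = fst I + 1)"

definition even_near_critical :: "'a set \<Rightarrow> nat \<Rightarrow> bool" where
  "even_near_critical A h \<longleftrightarrow> even (card A) \<and> h = card A"

text \<open>
  A move contains at most one crossing switch, since centered substrings overlap. So the
  crossing switches of the halfperiod \<open>\<pi> 0, \<dots>, \<pi> h\<close> are listed by the increasing list of
  the moves that contain one.
\<close>

definition crossing_moves :: "'a set \<Rightarrow> (int \<Rightarrow> 'a \<Rightarrow> nat) \<Rightarrow> nat \<Rightarrow> int list" where
  "crossing_moves A \<pi> h =
     sorted_list_of_set {i. 1 \<le> i \<and> i \<le> int h \<and> (\<exists>I. crossing_switch A \<pi> i I)}"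

definition crossing_substring_at :: "'a set \<Rightarrow> (int \<Rightarrow> 'a \<Rightarrow> nat) \<Rightarrow> int \<Rightarrow> 'a list" where
  "crossing_substring_at A \<pi> j =
     (case (THE I. crossing_switch A \<pi> j I) of
        (a, b) \<Rightarrow> map (inv_into A (\<pi> (j - 1))) [a..<Suc b])"

definition crossing_substrings :: "'a set \<Rightarrow> (int \<Rightarrow> 'a \<Rightarrow> nat) \<Rightarrow> nat \<Rightarrow> 'a list list" where
  "crossing_substrings A \<pi> h = map (crossing_substring_at A \<pi>) (crossing_moves A \<pi> h)"

text \<open>
  The \<open>k\<close>-th element of the \<open>i\<close>-th crossing substring, both indices starting at 1.
\<close>

definition crossing_point :: "'a set \<Rightarrow> (int \<Rightarrow> 'a \<Rightarrow> nat) \<Rightarrow> nat \<Rightarrow> nat \<Rightarrow> nat \<Rightarrow> 'a" where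
  "crossing_point A \<pi> h i k = crossing_substrings A \<pi> h ! (i - 1) ! (k - 1)"

definition central_signature :: "'a set \<Rightarrow> (int \<Rightarrow> 'a \<Rightarrow> nat) \<Rightarrow> nat \<Rightarrow> nat list" where
  "central_signature A \<pi> h = map (\<lambda>s. length s div 2) (crossing_substrings A \<pi> h)"

datatype letter = C | P | R | L

definition path_letter :: "'a set \<Rightarrow> (int \<Rightarrow> 'a \<Rightarrow> nat) \<Rightarrow> 'a \<Rightarrow> int \<Rightarrow> letter" where
  "path_letter A \<pi> p i =
     (if \<exists>I. crossing_switch A \<pi> i I \<and> in_substring (\<pi> (i - 1)) I p then C
      else if \<not> (\<exists>I. is_switch A \<pi> i I \<and> in_substring (\<pi> (i - 1)) I p) then P
      else if \<pi> (i - 1) p < \<pi> i p then R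
      else L)"

definition path :: "'a set \<Rightarrow> (int \<Rightarrow> 'a \<Rightarrow> nat) \<Rightarrow> 'a \<Rightarrow> letter list" where
  "path A \<pi> p = map (path_letter A \<pi> p) [1..int (card A)]"

abbreviation letter_power :: "letter \<Rightarrow> nat \<Rightarrow> letter list" (infixr "\<up>" 80) where
  "X \<up> m \<equiv> replicate m X"

end

theory Submission
  imports Defs
begin

text \<open>
  Number the \<open>2 * n\<close> positions and look only at the right half \<open>n + 1, \<dots>, 2 * n\<close>. At every time it
  contains one point of each conjugate pair, and a crossing switch that reverses \<open>2 * d\<close> points
  merely replaces the \<open>d\<close> innermost points of the right half by their conjugates, leaving
  all distances from the center unchanged. So the \<open>n\<close> conjugate pairs perform a motion on \<open>n\<close> places by adjacent transpositions.
  Two pairs that belong to the same crossing switch never change their radial order; two pairs of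
  different crossing switches, taking place at moves \<open>m < m' < m + 2 * n\<close>, change it exactly once
  strictly between \<open>m\<close> and \<open>m'\<close>: at \<open>m\<close> the first is inside the second, just before
  \<open>m'\<close> it is outside, and two points exchange only once in a halfperiod.

  Let \<open>D m\<close> be half the number of points reversed at \<open>m\<close>, let \<open>E m j\<close> be the point at
  position \<open>n + j\<close> right after move \<open>m\<close>, for \<open>1 \<le> j \<le> D m\<close>, and let \<open>T m j m' j'\<close> be the move in
  which \<open>E m j\<close> passes the conjugate of \<open>E m' j'\<close>. As the order inside a crossing substring is
  kept and a transposition involves one partner only, \<open>T\<close> is strictly increasing in \<open>j'\<close> and
  strictly decreasing in \<open>j\<close>. For consecutive crossing moves this already needs
  \<open>D m + D m' - 1\<close> moves strictly between \<open>m\<close> and \<open>m'\<close>, whence \<open>D m + D m' \<le> m' - m\<close>. Around a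
  halfperiod these lower bounds add up to \<open>2 * n\<close>, the length of the halfperiod, so all of them
  are equalities (lemma \<open>gap\<close>); this gives the numbers \<open>\<delta> i\<close>.

  The passing times are then forced as well (lemma \<open>T_eq\<close>). By induction on the number of moves
  between \<open>m\<close> and \<open>m'\<close>, the outermost point of the substring at \<open>m\<close> is occupied right after \<open>m\<close>
  by the points of all intermediate crossing switches and cannot pass a point belonging to \<open>m'\<close>
  earlier; symmetrically in time, the outermost point belonging to \<open>m'\<close> is occupied right
  before \<open>m'\<close>. With monotonicity there is only one possibility left. The passings of \<open>E m j\<close>
  on its way outwards therefore fill one interval of \<open>n - D m\<close> consecutive moves, those on its way
  back fill another one, and in between and at both ends it rests. Reading this off on the two
  sides of the crossing at \<open>m = \<delta> i + 1\<close> and cutting the word to the moves \<open>1, \<dots>, 2 * n\<close>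
  gives the cases of the theorem.
\<close>

section \<open>Single moves\<close>

lemma move_inside:
  assumes "is_move A \<sigma> \<tau> B" "p \<in> A" "(a, b) \<in> B" "a \<le> \<sigma> p" "\<sigma> p \<le> b"
  shows "\<tau> p + \<sigma> p = a + b"
  using assms unfolding is_move_def in_substring_def by fastforce

lemma move_outside:
  assumes "is_move A \<sigma> \<tau> B" "p \<in> A" "\<And>a b. (a, b) \<in> B \<Longrightarrow> \<not> (a \<le> \<sigma> p \<and> \<sigma> p \<le> b)"
  shows "\<tau> p = \<sigma> p"
  using assms unfolding is_move_def in_substring_def by fastforce

lemma move_disjoint:
  assumes "is_move A \<sigma> \<tau> B" "(a, b) \<in> B" "(a', b') \<in> B" "(a, b) \<noteq> (a', b')"
  shows "b < a' \<or> b' < a"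
proof -
  have all: "\<forall>(a, b)\<in>B. \<forall>(a', b')\<in>B. (a, b) \<noteq> (a', b') \<longrightarrow> {a..b} \<inter> {a'..b'} = {}"
    and less: "\<forall>(a, b)\<in>B. 1 \<le> a \<and> a < b \<and> b \<le> card A"
    using assms(1) unfolding is_move_def by simp_all
  have "{a..b} \<inter> {a'..b'} = {}" using all assms(2-4) by auto
  moreover have "a < b" "a' < b'" using less assms(2,3) by auto
  ultimately have "{a..b} \<inter> {a'..b'} = {}" "a < b" "a' < b'" by simp_all
  then have "max a a' \<notin> {a..b} \<inter> {a'..b'}" by blast
  then show ?thesis using \<open>a < b\<close> \<open>a' < b'\<close> by (auto simp: max_def split: if_splits)
qed

lemma move_flips_inside:
  assumes "is_move A \<sigma> \<tau> B" "p \<in> A" "q \<in> A" "\<sigma> p < \<sigma> q"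
    and "I \<in> B" "in_substring \<sigma> I p" "in_substring \<sigma> I q"
  shows "\<tau> q < \<tau> p"
proof -
  obtain a b where I: "I = (a, b)" by (cases I)
  then have "\<tau> p + \<sigma> p = a + b" "\<tau> q + \<sigma> q = a + b"
    using assms move_inside[of A \<sigma> \<tau> B _ a b] by (auto simp: in_substring_def)
  then show ?thesis using assms(4) by linarith
qed

lemma move_keeps_outside:
  assumes mv: "is_move A \<sigma> \<tau> B" and A: "p \<in> A" "q \<in> A" and less: "\<sigma> p < \<sigma> q"
    and sep: "\<And>I. I \<in> B \<Longrightarrow> \<not> (in_substring \<sigma> I p \<and> in_substring \<sigma> I q)"
  shows "\<tau> p < \<tau> q"
proof -
  have p: "\<tau> p = \<sigma> p \<or> (\<exists>a b. (a, b) \<in> B \<and> a \<le> \<sigma> p \<and> \<sigma> p \<le> b \<and> \<tau> p + \<sigma> p = a + b)"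
    using move_inside[OF mv A(1)] move_outside[OF mv A(1)] by blast
  have q: "((\<forall>a b. (a, b) \<in> B \<longrightarrow> \<not> (a \<le> \<sigma> q \<and> \<sigma> q \<le> b)) \<and> \<tau> q = \<sigma> q)
     \<or> (\<exists>a b. (a, b) \<in> B \<and> a \<le> \<sigma> q \<and> \<sigma> q \<le> b \<and> \<tau> q + \<sigma> q = a + b)"
    using move_inside[OF mv A(2)] move_outside[OF mv A(2)] by blast
  have sep': "\<not> (a \<le> \<sigma> p \<and> \<sigma> q \<le> b)" if "(a, b) \<in> B" for a b
    using sep[OF that] less by (auto simp: in_substring_def)
  from p show ?thesis
  proof
    assume p: "\<tau> p = \<sigma> p"
    from q show ?thesis
    proof
      assume "\<exists>a b. (a, b) \<in> B \<and> a \<le> \<sigma> q \<and> \<sigma> q \<le> b \<and> \<tau> q + \<sigma> q = a + b"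
      then obtain a b where ab: "(a, b) \<in> B" "a \<le> \<sigma> q" "\<sigma> q \<le> b" "\<tau> q + \<sigma> q = a + b" by blast
      then show ?thesis using sep'[OF ab(1)] p by linarith
    qed (use p less in simp)
  next
    assume "\<exists>a b. (a, b) \<in> B \<and> a \<le> \<sigma> p \<and> \<sigma> p \<le> b \<and> \<tau> p + \<sigma> p = a + b"
    then obtain a b where ab: "(a, b) \<in> B" "a \<le> \<sigma> p" "\<sigma> p \<le> b" "\<tau> p + \<sigma> p = a + b" by blast
    have b: "b < \<sigma> q" using sep'[OF ab(1)] ab by linarith
    from q show ?thesis
    proof
      assume "\<exists>a b. (a, b) \<in> B \<and> a \<le> \<sigma> q \<and> \<sigma> q \<le> b \<and> \<tau> q + \<sigma> q = a + b"
      then obtain a' b' where ab': "(a', b') \<in> B" "a' \<le> \<sigma> q" "\<sigma> q \<le> b'" "\<tau> q + \<sigma> q = a' + b'"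
        by blast
      have "(a, b) \<noteq> (a', b')" using b ab' by auto
      from move_disjoint[OF mv ab(1) ab'(1) this] show ?thesis using ab ab' b by linarith
    qed (use ab b in linarith)
  qed
qed

section \<open>Words given by runs of equal letters\<close>

lemma map_run:
  assumes "\<And>\<tau>. x \<le> \<tau> \<Longrightarrow> \<tau> < x + int k \<Longrightarrow> f \<tau> = X"
    and "x + int k \<le> z + 1" and "map f [x + int k..z] = ys"
  shows "map f [x..z] = replicate k X @ ys"
  using assms
proof (induction k arbitrary: x)
  case (Suc k)
  have "[x..z] = x # [x + 1..z]" using Suc.prems(2) by (simp add: upto_rec1)
  moreover have "map f [x + 1..z] = replicate k X @ ys"
    using Suc.prems by (intro Suc.IH) (auto simp: algebra_simps)
  ultimately show ?case using Suc.prems(1)[of x] by simp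
qed simp

lemma map_last_run:
  assumes "\<And>\<tau>. x \<le> \<tau> \<Longrightarrow> \<tau> \<le> z \<Longrightarrow> f \<tau> = X" and "x + int k = z + 1"
  shows "map f [x..z] = replicate k X"
  using map_run[of x k f X z "[]"] assms by simp

lemma map_point:
  assumes "f x = X" "x \<le> z" "map f [x + 1..z] = ys"
  shows "map f [x..z] = [X] @ ys"
  using map_run[of x 1 f X z ys] assms by simp

section \<open>Centrally symmetric sequences in noncentral general position\<close>

locale symmetric_sequence =
  fixes A :: "'a set" and \<pi> :: "int \<Rightarrow> 'a \<Rightarrow> nat" and n :: nat
  assumes card_A: "card A = 2 * n"
    and allowable: "allowable_sequence A \<pi> (2 * n)"
    and symmetric: "centrally_symmetric A \<pi>"
    and general_position: "noncentral_general_position A \<pi>"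
begin

lemma n_pos: "0 < n"
  using allowable by (simp add: allowable_sequence_def)

lemma finite_A: "finite A"
  using allowable by (simp add: allowable_sequence_def)

lemma bij: "bij_betw (\<pi> i) A {1..2 * n}"
  using allowable card_A by (simp add: allowable_sequence_def is_permutation_def)

lemma position_range:
  assumes "p \<in> A" shows "1 \<le> \<pi> i p" "\<pi> i p \<le> 2 * n"
  using bij_betwE[OF bij[of i]] assms by auto

lemma position_inj: "p \<in> A \<Longrightarrow> q \<in> A \<Longrightarrow> \<pi> i p = \<pi> i q \<longleftrightarrow> p = q"
  using bij_betw_imp_inj_on[OF bij[of i]] by (auto simp: inj_on_def)

lemma reversal: "p \<in> A \<Longrightarrow> \<pi> (i + 2 * int n) p + \<pi> i p = 2 * n + 1"
  using allowable card_A by (simp add: allowable_sequence_def)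

lemma ex_move: "\<exists>B. is_move A (\<pi> (i - 1)) (\<pi> i) B"
  using allowable by (simp add: allowable_sequence_def)

text \<open>
  The argument uses switches mostly through the changes of relative order that they cause. This
  makes the invariance under a shift by a halfperiod immediate.
\<close>

definition flips :: "int \<Rightarrow> 'a \<Rightarrow> 'a \<Rightarrow> bool" where
  "flips i p q \<longleftrightarrow> (\<pi> (i - 1) p < \<pi> (i - 1) q) \<noteq> (\<pi> i p < \<pi> i q)"

lemma flips_sym: "p \<in> A \<Longrightarrow> q \<in> A \<Longrightarrow> flips i p q \<longleftrightarrow> flips i q p"
  unfolding flips_def using position_inj[of p q i] position_inj[of p q "i - 1"] by auto

lemma flips_iff_common_switch:
  assumes "p \<in> A" "q \<in> A" "p \<noteq> q"
  shows "flips i p q \<longleftrightarrow>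
    (\<exists>I. is_switch A \<pi> i I \<and> in_substring (\<pi> (i - 1)) I p \<and> in_substring (\<pi> (i - 1)) I q)"
proof -
  have *: "flips i p q \<longleftrightarrow>
    (\<exists>I. is_switch A \<pi> i I \<and> in_substring (\<pi> (i - 1)) I p \<and> in_substring (\<pi> (i - 1)) I q)"
    if A: "p \<in> A" "q \<in> A" and less: "\<pi> (i - 1) p < \<pi> (i - 1) q" for p q
  proof
    assume "flips i p q"
    then have nl: "\<not> \<pi> i p < \<pi> i q" using less by (simp add: flips_def)
    obtain B where B: "is_move A (\<pi> (i - 1)) (\<pi> i) B" using ex_move by blast
    from move_keeps_outside[OF B A less] nl
    show "\<exists>I. is_switch A \<pi> i I \<and> in_substring (\<pi> (i - 1)) I p \<and> in_substring (\<pi> (i - 1)) I q"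
      using B unfolding is_switch_def by blast
  next
    assume "\<exists>I. is_switch A \<pi> i I \<and> in_substring (\<pi> (i - 1)) I p \<and> in_substring (\<pi> (i - 1)) I q"
    then have "\<pi> i q < \<pi> i p"
      unfolding is_switch_def using move_flips_inside[OF _ A less] by blast
    then show "flips i p q" using less by (simp add: flips_def)
  qed
  have "\<pi> (i - 1) p < \<pi> (i - 1) q \<or> \<pi> (i - 1) q < \<pi> (i - 1) p"
    using position_inj assms by (metis linorder_neq_iff)
  then show ?thesis using *[of p q] *[of q p] flips_sym assms by blast
qed

lemma flips_periodic:
  assumes "p \<in> A" "q \<in> A"
  shows "flips (i + 2 * int n) p q \<longleftrightarrow> flips i p q"
proof (cases "p = q")
  case False
  have reversed: "\<pi> (j + 2 * int n) p < \<pi> (j + 2 * int n) q \<longleftrightarrow> \<not> \<pi> j p < \<pi> j q" for j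
    using reversal[OF assms(1), of j] reversal[OF assms(2), of j]
      position_inj[OF assms, of j] False by linarith
  show ?thesis
    using reversed[of i] reversed[of "i - 1"] by (auto simp: flips_def algebra_simps)
qed (simp add: flips_def)

lemma flips_periodic_mult:
  assumes "p \<in> A" "q \<in> A"
  shows "flips (i + 2 * int n * z) p q \<longleftrightarrow> flips i p q"
proof (induction z rule: int_induct[where k = 0])
  case (step1 z)
  have e: "i + 2 * int n * (z + 1) = (i + 2 * int n * z) + 2 * int n" by (simp add: algebra_simps)
  show ?case unfolding e flips_periodic[OF assms] by (rule step1)
next
  case (step2 z)
  have e: "i + 2 * int n * z = (i + 2 * int n * (z - 1)) + 2 * int n" by (simp add: algebra_simps)
  show ?case using step2(2) flips_periodic[OF assms] unfolding e by blast
qed simp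

text \<open>
  Uniqueness of the common switch is given for the moves \<open>1, \<dots>, 2 * n\<close> only; by periodicity two
  flips of the same pair differ by a multiple of \<open>2 * n\<close>.
\<close>

lemma flips_separated:
  assumes A: "p \<in> A" "q \<in> A" and f: "flips i p q" "flips j p q" and less: "i < j"
  shows "i + 2 * int n \<le> j"
proof -
  let ?h = "2 * int n"
  have neq: "p \<noteq> q" using f by (auto simp: flips_def)
  have ex1: "\<exists>!i. i \<in> {1..?h} \<and> flips i p q"
    using allowable A neq flips_iff_common_switch[OF A neq]
    by (simp add: allowable_sequence_def)
  define r where "r i = (i - 1) mod ?h + 1" for i
  have r: "r i \<in> {1..?h}" for i
  proof -
    have "0 \<le> (i - 1) mod ?h" "(i - 1) mod ?h < ?h" using n_pos by (simp_all del: mod_mult_mult1)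
    then show ?thesis unfolding r_def atLeastAtMost_iff by linarith
  qed
  have i: "i = r i + ?h * ((i - 1) div ?h)" for i by (simp add: r_def)
  have "flips (r i) p q" "flips (r j) p q"
    using f i flips_periodic_mult[OF A] by metis+
  then have "r i = r j" using ex1 r by blast
  then have "(j - 1) mod ?h = (i - 1) mod ?h" by (simp add: r_def)
  then have "?h dvd (j - 1) - (i - 1)" by (simp only: mod_eq_dvd_iff)
  then have "?h dvd j - i" by simp
  then show ?thesis using less zdvd_imp_le by fastforce
qed

lemma order_change_flips:
  assumes "s \<le> s'" "(\<pi> s p < \<pi> s q) \<noteq> (\<pi> s' p < \<pi> s' q)"
  shows "\<exists>i. s < i \<and> i \<le> s' \<and> flips i p q"
  using assms
proof (induction s' rule: int_ge_induct)
  case (step j)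
  show ?case
  proof (cases "(\<pi> s p < \<pi> s q) = (\<pi> j p < \<pi> j q)")
    case True
    then have "flips (j + 1) p q" using step by (simp add: flips_def)
    then show ?thesis using step by (intro exI[of _ "j + 1"]) auto
  next
    case False
    then show ?thesis using step by force
  qed
qed simp

text \<open>
  A pair with the same order at both ends of a period of length at most \<open>2 * n\<close> would have to flip
  twice in it to have another order in between.
\<close>

lemma order_convex:
  assumes A: "p \<in> A" "q \<in> A" and t: "s \<le> i" "i \<le> s'" "s' \<le> s + 2 * int n"
    and same: "(\<pi> s p < \<pi> s q) = (\<pi> s' p < \<pi> s' q)"
  shows "(\<pi> i p < \<pi> i q) = (\<pi> s p < \<pi> s q)"
proof (rule ccontr)
  assume ne: "(\<pi> i p < \<pi> i q) \<noteq> (\<pi> s p < \<pi> s q)"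
  obtain x where x: "s < x" "x \<le> i" "flips x p q"
    using order_change_flips[OF t(1)] ne by metis
  obtain y where y: "i < y" "y \<le> s'" "flips y p q"
    using order_change_flips[OF t(2)] ne same by metis
  show False using flips_separated[OF A x(3) y(3)] x y t by linarith
qed

lemma ex_antipode:
  assumes "p \<in> A" shows "\<exists>q\<in>A. \<forall>i. \<pi> i p + \<pi> i q = 2 * n + 1"
  using symmetric assms card_A by (simp add: centrally_symmetric_def)

definition antipode :: "'a \<Rightarrow> 'a" where
  "antipode p = (SOME q. q \<in> A \<and> (\<forall>i. \<pi> i p + \<pi> i q = 2 * n + 1))"

lemma antipode:
  assumes "p \<in> A"
  shows antipode_in: "antipode p \<in> A" and antipode_position: "\<pi> i p + \<pi> i (antipode p) = 2 * n + 1"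
  using someI_ex[of "\<lambda>q. q \<in> A \<and> (\<forall>i. \<pi> i p + \<pi> i q = 2 * n + 1)"] ex_antipode[OF assms]
  unfolding antipode_def by blast+

lemma antipode_less_iff: "p \<in> A \<Longrightarrow> \<pi> i (antipode p) < \<pi> i p \<longleftrightarrow> n < \<pi> i p"
  using antipode_position[of p i] by linarith

text \<open>
  The points of a crossing switch are exactly those that change sides, and a change of sides is a
  flip of a point with its conjugate.
\<close>

definition crosses :: "int \<Rightarrow> 'a \<Rightarrow> bool" where
  "crosses i p \<longleftrightarrow> (n < \<pi> (i - 1) p) \<noteq> (n < \<pi> i p)"

lemma crosses_iff_flips: "p \<in> A \<Longrightarrow> crosses i p \<longleftrightarrow> flips i (antipode p) p"
  by (simp add: crosses_def flips_def antipode_less_iff)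

lemma side_convex:
  assumes "p \<in> A" "s \<le> i" "i \<le> s'" "s' \<le> s + 2 * int n"
    and "(n < \<pi> s p) = (n < \<pi> s' p)"
  shows "(n < \<pi> i p) = (n < \<pi> s p)"
  using order_convex[OF antipode_in[OF assms(1)] assms(1-4)] assms(1,5)
  by (simp add: antipode_less_iff)

lemma crosses_separated:
  assumes "p \<in> A" "crosses i p" "crosses j p" "i < j"
  shows "i + 2 * int n \<le> j"
  using assms flips_separated[OF antipode_in[OF assms(1)] assms(1)] by (simp add: crosses_iff_flips)

lemma ex_crossing:
  assumes "p \<in> A"
  shows "\<exists>i. s < i \<and> i \<le> s + 2 * int n \<and> crosses i p"
proof -
  have "(\<pi> s (antipode p) < \<pi> s p) \<noteq>
      (\<pi> (s + 2 * int n) (antipode p) < \<pi> (s + 2 * int n) p)"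
    using reversal[OF assms, of s] by (simp add: antipode_less_iff assms, linarith)
  from order_change_flips[OF _ this] show ?thesis
    by (simp add: crosses_iff_flips assms)
qed

lemma switch_range:
  assumes "is_switch A \<pi> i (a, b)" shows "1 \<le> a" "a < b" "b \<le> 2 * n"
proof -
  have "1 \<le> a \<and> a < b \<and> b \<le> card A"
    using assms unfolding is_switch_def is_move_def by blast
  then show "1 \<le> a" "a < b" "b \<le> 2 * n" by (simp_all add: card_A)
qed

lemma switch_reverses:
  assumes "is_switch A \<pi> i (a, b)" "p \<in> A" "a \<le> \<pi> (i - 1) p" "\<pi> (i - 1) p \<le> b"
  shows "\<pi> i p + \<pi> (i - 1) p = a + b"
proof -
  obtain B where "is_move A (\<pi> (i - 1)) (\<pi> i) B" "(a, b) \<in> B"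
    using assms(1) unfolding is_switch_def by blast
  then show ?thesis using move_inside assms(2-4) by metis
qed

lemma noncrossing_transposition:
  assumes "is_switch A \<pi> i (a, b)" "\<not> crossing_switch A \<pi> i (a, b)"
  shows "b = a + 1"
  using assms general_position unfolding noncentral_general_position_def by force

lemma crosses_iff:
  assumes "p \<in> A"
  shows "crosses i p \<longleftrightarrow> (\<exists>I. crossing_switch A \<pi> i I \<and> in_substring (\<pi> (i - 1)) I p)"
proof
  assume c: "crosses i p"
  obtain B where B: "is_move A (\<pi> (i - 1)) (\<pi> i) B" using ex_move by blast
  have "\<pi> i p \<noteq> \<pi> (i - 1) p" using c by (auto simp: crosses_def)
  then obtain a b where ab: "(a, b) \<in> B" "a \<le> \<pi> (i - 1) p" "\<pi> (i - 1) p \<le> b"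
    using move_outside[OF B assms] by blast
  have sw: "is_switch A \<pi> i (a, b)" using B ab unfolding is_switch_def by blast
  have "crossing_switch A \<pi> i (a, b)"
  proof (rule ccontr)
    assume nc: "\<not> crossing_switch A \<pi> i (a, b)"
    have "b = a + 1" by (rule noncrossing_transposition[OF sw nc])
    moreover have "a + b \<noteq> 2 * n + 1" using sw nc card_A by (simp add: crossing_switch_def)
    ultimately show False using switch_reverses[OF sw assms ab(2,3)] c ab(2,3)
      unfolding crosses_def by linarith
  qed
  then show "\<exists>I. crossing_switch A \<pi> i I \<and> in_substring (\<pi> (i - 1)) I p"
    using ab by (auto simp: in_substring_def)
next
  assume "\<exists>I. crossing_switch A \<pi> i I \<and> in_substring (\<pi> (i - 1)) I p"
  then obtain a b where ab: "crossing_switch A \<pi> i (a, b)" "a \<le> \<pi> (i - 1) p" "\<pi> (i - 1) p \<le> b"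
    by (auto simp: in_substring_def)
  then have "is_switch A \<pi> i (a, b)" "a + b = 2 * n + 1"
    by (simp_all add: crossing_switch_def card_A)
  with switch_reverses[OF _ assms ab(2,3)] have "\<pi> i p + \<pi> (i - 1) p = 2 * n + 1" by simp
  then show "crosses i p" unfolding crosses_def by linarith
qed

lemma crosses_reflects:
  assumes "p \<in> A" "crosses i p"
  shows "\<pi> i p + \<pi> (i - 1) p = 2 * n + 1"
proof -
  obtain a b where ab: "crossing_switch A \<pi> i (a, b)" "a \<le> \<pi> (i - 1) p" "\<pi> (i - 1) p \<le> b"
    using assms crosses_iff by (auto simp: in_substring_def)
  then have "is_switch A \<pi> i (a, b)" "a + b = 2 * n + 1"
    by (simp_all add: crossing_switch_def card_A)
  with switch_reverses[OF _ assms(1) ab(2,3)] show ?thesis by simp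
qed

lemma flips_transposes:
  assumes A: "p \<in> A" "q \<in> A" and f: "flips i p q" and nc: "\<not> crosses i p"
    and less: "\<pi> (i - 1) p < \<pi> (i - 1) q"
  shows "\<pi> (i - 1) q = \<pi> (i - 1) p + 1" "\<pi> i p = \<pi> (i - 1) p + 1" "\<pi> i q = \<pi> (i - 1) p"
proof -
  have "p \<noteq> q" using less by auto
  then obtain a b where sw: "is_switch A \<pi> i (a, b)"
    and p: "a \<le> \<pi> (i - 1) p" "\<pi> (i - 1) p \<le> b" and q: "a \<le> \<pi> (i - 1) q" "\<pi> (i - 1) q \<le> b"
    using flips_iff_common_switch[OF A] f by (auto simp: in_substring_def)
  have "\<not> crossing_switch A \<pi> i (a, b)"
    using nc p crosses_iff[OF A(1)] by (auto simp: in_substring_def)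
  from noncrossing_transposition[OF sw this] have b: "b = a + 1" .
  show "\<pi> (i - 1) q = \<pi> (i - 1) p + 1" "\<pi> i p = \<pi> (i - 1) p + 1" "\<pi> i q = \<pi> (i - 1) p"
    using switch_reverses[OF sw A(1) p] switch_reverses[OF sw A(2) q] b p q less by linarith+
qed

lemma ex_at_position:
  assumes "1 \<le> x" "x \<le> 2 * n" shows "\<exists>p\<in>A. \<pi> i p = x"
  using bij_betw_imp_surj_on[OF bij[of i]] assms by (metis atLeastAtMost_iff imageE)

lemma switch_moves:
  assumes A: "p \<in> A" and nc: "\<not> crosses i p"
    and I: "is_switch A \<pi> i I" "in_substring (\<pi> (i - 1)) I p"
  shows "\<exists>q\<in>A. q \<noteq> p \<and> flips i p q" "\<pi> i p \<noteq> \<pi> (i - 1) p"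
proof -
  obtain a b where ab: "I = (a, b)" by (cases I)
  then have sw: "is_switch A \<pi> i (a, b)" and p: "a \<le> \<pi> (i - 1) p" "\<pi> (i - 1) p \<le> b"
    using I by (auto simp: in_substring_def)
  have "\<not> crossing_switch A \<pi> i (a, b)"
    using nc p crosses_iff[OF A(1)] by (auto simp: in_substring_def)
  from noncrossing_transposition[OF sw this] have b: "b = a + 1" .
  show "\<pi> i p \<noteq> \<pi> (i - 1) p" using switch_reverses[OF sw A p] b p by presburger
  define x where "x = (if \<pi> (i - 1) p = a then b else a)"
  have "1 \<le> x" "x \<le> 2 * n" using switch_range[OF sw] by (simp_all add: x_def)
  then obtain q where q: "q \<in> A" "\<pi> (i - 1) q = (if \<pi> (i - 1) p = a then b else a)"
    using ex_at_position[of x "i - 1"] unfolding x_def by blast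
  have "q \<noteq> p" using q(2) b p by (auto split: if_splits)
  moreover have "in_substring (\<pi> (i - 1)) I q" using q(2) ab b by (auto simp: in_substring_def)
  ultimately show "\<exists>q\<in>A. q \<noteq> p \<and> flips i p q"
    using flips_iff_common_switch[OF A q(1)] q(1) I by blast
qed

lemma in_some_switch:
  assumes A: "p \<in> A" and mv: "\<pi> i p \<noteq> \<pi> (i - 1) p"
  shows "\<exists>I. is_switch A \<pi> i I \<and> in_substring (\<pi> (i - 1)) I p"
proof -
  obtain B where B: "is_move A (\<pi> (i - 1)) (\<pi> i) B" using ex_move by blast
  obtain a b where "(a, b) \<in> B" "a \<le> \<pi> (i - 1) p" "\<pi> (i - 1) p \<le> b"
    using move_outside[OF B A] mv by blast
  then show ?thesis using B by (auto simp: is_switch_def in_substring_def)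
qed

lemma path_letter_eq:
  assumes "p \<in> A"
  shows "path_letter A \<pi> p i =
    (if crosses i p then C else if \<pi> i p = \<pi> (i - 1) p then P
     else if \<pi> (i - 1) p < \<pi> i p then R else L)"
  using crosses_iff[OF assms, of i] in_some_switch[OF assms, of i] switch_moves(2)[OF assms, of i]
  unfolding path_letter_def by auto

section \<open>Crossing switches\<close>

text \<open>
  Being \<open>0\<close> for a move without a crossing switch, \<open>D\<close> can be summed over intervals of moves without
  selecting the crossing ones.
\<close>

definition D :: "int \<Rightarrow> nat" where
  "D i = card {p \<in> A. crosses i p} div 2"

lemma card_positions:
  assumes "X \<subseteq> {1..2 * n}" shows "card {p \<in> A. \<pi> i p \<in> X} = card X"
proof -
  have "\<pi> i ` {p \<in> A. \<pi> i p \<in> X} = X"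
    using ex_at_position[of _ i] assms by fastforce
  moreover have "inj_on (\<pi> i) {p \<in> A. \<pi> i p \<in> X}"
    by (rule inj_on_subset[OF bij_betw_imp_inj_on[OF bij[of i]]]) blast
  ultimately show ?thesis using card_image by metis
qed

text \<open>
  The crossing switch of a move is unique: if a move could be described with two different
  centered substrings, the end point of the larger one would have to change sides, but in the
  description with the smaller one it can only move within a substring on its own side.
\<close>

lemma crossing_switch_central:
  assumes "crossing_switch A \<pi> i I"
  shows "I = (n + 1 - D i, n + D i)" "0 < D i" "D i \<le> n"
    and "\<And>p. p \<in> A \<Longrightarrow> crosses i p \<longleftrightarrow> n + 1 \<le> \<pi> (i - 1) p + D i \<and> \<pi> (i - 1) p \<le> n + D i"
proof -
  have form: "\<exists>d. I = (n + 1 - d, n + d) \<and> 0 < d \<and> d \<le> n" if "crossing_switch A \<pi> i I" for I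
  proof -
    obtain a b where ab: "I = (a, b)" by (cases I)
    then have sw: "is_switch A \<pi> i (a, b)" and sum: "a + b = 2 * n + 1"
      using that by (simp_all add: crossing_switch_def card_A)
    show ?thesis
      using switch_range[OF sw] sum ab by (intro exI[of _ "b - n"]) auto
  qed
  obtain d where d: "I = (n + 1 - d, n + d)" "0 < d" "d \<le> n" using form[OF assms] by blast
  have larger: False
    if I': "crossing_switch A \<pi> i (n + 1 - d', n + d')" and "d'' < d'"
      and d': "0 < d'" "d' \<le> n"
      and I'': "crossing_switch A \<pi> i (n + 1 - d'', n + d'')" and "0 < d''" for d' d''
  proof -
    obtain p where p: "p \<in> A" "\<pi> (i - 1) p = n + d'"
      using ex_at_position[of "n + d'" "i - 1"] d' by auto
    obtain B where B: "is_move A (\<pi> (i - 1)) (\<pi> i) B" "(n + 1 - d'', n + d'') \<in> B"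
      using I'' unfolding crossing_switch_def is_switch_def by blast
    have "in_substring (\<pi> (i - 1)) (n + 1 - d', n + d') p" using p d' by (simp add: in_substring_def)
    then have "crosses i p" using I' crosses_iff[OF p(1)] by blast
    then have refl: "\<pi> i p + (n + d') = 2 * n + 1"
      using crosses_reflects[OF p(1), of i] unfolding p(2) by blast
    then have "\<pi> i p \<noteq> \<pi> (i - 1) p" using p(2) d' by presburger
    then obtain a b where ab: "(a, b) \<in> B" "a \<le> \<pi> (i - 1) p" "\<pi> (i - 1) p \<le> b"
      using move_outside[OF B(1) p(1)] by blast
    have "\<pi> i p + \<pi> (i - 1) p = a + b" by (rule move_inside[OF B(1) p(1) ab])
    then have "a \<le> \<pi> i p" using ab by linarith
    have "(a, b) \<noteq> (n + 1 - d'', n + d'')" using ab p(2) \<open>d'' < d'\<close> by auto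
    from move_disjoint[OF B(1) ab(1) B(2) this] show False
      using \<open>a \<le> \<pi> i p\<close> ab refl p(2) d' \<open>d'' < d'\<close> \<open>0 < d''\<close> by linarith
  qed
  have unique: "I' = I" if cross: "crossing_switch A \<pi> i I'" for I'
  proof -
    obtain d' where d': "I' = (n + 1 - d', n + d')" "0 < d'" "d' \<le> n" using form[OF cross] by blast
    have "\<not> d < d'" "\<not> d' < d" using larger[of d' d] larger[of d d'] cross assms d d' by auto
    then show ?thesis using d d' by simp
  qed
  have cr: "crosses i p \<longleftrightarrow> n + 1 \<le> \<pi> (i - 1) p + d \<and> \<pi> (i - 1) p \<le> n + d" if "p \<in> A" for p
  proof -
    have "crosses i p \<longleftrightarrow> in_substring (\<pi> (i - 1)) I p"
      using crosses_iff[OF that] unique assms by blast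
    then show ?thesis using d by (auto simp: in_substring_def)
  qed
  then have "{p \<in> A. crosses i p} = {p \<in> A. \<pi> (i - 1) p \<in> {n + 1 - d..n + d}}" by auto
  moreover have "card {p \<in> A. \<pi> (i - 1) p \<in> {n + 1 - d..n + d}} = card {n + 1 - d..n + d}"
    by (rule card_positions) (use d in auto)
  ultimately have D: "D i = d" using d by (simp add: D_def)
  show "I = (n + 1 - D i, n + D i)" "0 < D i" "D i \<le> n"
    and "\<And>p. p \<in> A \<Longrightarrow> crosses i p \<longleftrightarrow> n + 1 \<le> \<pi> (i - 1) p + D i \<and> \<pi> (i - 1) p \<le> n + D i"
    using d cr unfolding D by auto
qed

lemma no_crossing_switch:
  assumes "\<not> (\<exists>I. crossing_switch A \<pi> i I)"
  shows "D i = 0" and "\<And>p. p \<in> A \<Longrightarrow> \<not> crosses i p"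
proof -
  show nc: "\<not> crosses i p" if "p \<in> A" for p using crosses_iff[OF that] assms by blast
  have "{p \<in> A. crosses i p} = {}" using nc by blast
  then show "D i = 0" unfolding D_def by (simp only: card.empty div_0)
qed

lemma D_pos_iff: "0 < D i \<longleftrightarrow> (\<exists>I. crossing_switch A \<pi> i I)"
  using crossing_switch_central(2)[of i] no_crossing_switch(1)[of i] by (metis less_numeral_extra(3))

lemma D_le: "D i \<le> n"
  using crossing_switch_central(3)[of i] no_crossing_switch(1)[of i] by (metis le0)

lemma crosses_iff_before:
  assumes "p \<in> A"
  shows "crosses i p \<longleftrightarrow> n + 1 \<le> \<pi> (i - 1) p + D i \<and> \<pi> (i - 1) p \<le> n + D i"
  using crossing_switch_central(4)[of i _ p] no_crossing_switch[of i] assms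
  by (cases "\<exists>I. crossing_switch A \<pi> i I") auto

text \<open>
  The central substring occupies the same positions before and after its reversal.
\<close>

lemma crosses_iff_after:
  assumes "p \<in> A"
  shows "crosses i p \<longleftrightarrow> n + 1 \<le> \<pi> i p + D i \<and> \<pi> i p \<le> n + D i"
proof
  assume c: "crosses i p"
  then show "n + 1 \<le> \<pi> i p + D i \<and> \<pi> i p \<le> n + D i"
    using crosses_reflects[OF assms c] crosses_iff_before[OF assms, of i] by linarith
next
  assume r: "n + 1 \<le> \<pi> i p + D i \<and> \<pi> i p \<le> n + D i"
  obtain q where q: "q \<in> A" "\<pi> (i - 1) q = 2 * n + 1 - \<pi> i p"
    using ex_at_position[of "2 * n + 1 - \<pi> i p" "i - 1"] position_range[OF assms, of i]
    by fastforce
  have c: "crosses i q" using crosses_iff_before[OF q(1), of i] q(2) r by linarith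
  have "\<pi> i q = \<pi> i p"
    using crosses_reflects[OF q(1) c] q(2) position_range[OF assms, of i] by linarith
  then show "crosses i p" using c position_inj[OF q(1) assms] by simp
qed

lemma crosses_periodic:
  assumes "p \<in> A" shows "crosses (i + 2 * int n) p \<longleftrightarrow> crosses i p"
  using flips_periodic[OF antipode_in[OF assms] assms] by (simp add: crosses_iff_flips assms)

lemma D_periodic: "D (i + 2 * int n) = D i"
proof -
  have "{p \<in> A. crosses (i + 2 * int n) p} = {p \<in> A. crosses i p}"
    using crosses_periodic by blast
  then show ?thesis by (simp add: D_def)
qed

lemma card_crossing: "card {p \<in> A. crosses i p} = 2 * D i"
proof -
  have "{p \<in> A. crosses i p} = {p \<in> A. \<pi> (i - 1) p \<in> {n + 1 - D i..n + D i}}"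
    using crosses_iff_before by auto
  moreover have "card {p \<in> A. \<pi> (i - 1) p \<in> {n + 1 - D i..n + D i}} = card {n + 1 - D i..n + D i}"
    by (rule card_positions) (use D_le[of i] in auto)
  ultimately show ?thesis using D_le[of i] by simp
qed

text \<open>
  Every point crosses exactly once in a halfperiod.
\<close>

lemma sum_D: "sum D {m<..m + 2 * int n} = n"
proof -
  let ?W = "{m<..m + 2 * int n}"
  have A: "A = (\<Union>i\<in>?W. {p \<in> A. crosses i p})" using ex_crossing[of _ m] by fastforce
  have "card A = (\<Sum>i\<in>?W. card {p \<in> A. crosses i p})"
  proof (subst A, rule card_UN_disjoint)
    have "i = j" if "i \<in> ?W" "j \<in> ?W" "p \<in> A" "crosses i p" "crosses j p" for i j p
      using crosses_separated[of p i j] crosses_separated[of p j i] that by fastforce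
    then show "\<forall>i\<in>?W. \<forall>j\<in>?W. i \<noteq> j \<longrightarrow> {p \<in> A. crosses i p} \<inter> {p \<in> A. crosses j p} = {}"
      by blast
  qed (use finite_A in auto)
  then have "2 * n = 2 * sum D ?W" by (simp add: card_A card_crossing sum_distrib_left)
  then show ?thesis by simp
qed

text \<open>
  Used for \<open>j \<in> {1..D m}\<close>: the points that enter the right half at move \<open>m\<close>, counted from the
  center outwards.
\<close>

definition E :: "int \<Rightarrow> nat \<Rightarrow> 'a" where
  "E m j = inv_into A (\<pi> m) (n + j)"

lemma E:
  assumes "j \<in> {1..D m}"
  shows E_in: "E m j \<in> A" and E_position: "\<pi> m (E m j) = n + j"
proof -
  have "1 \<le> n + j" "n + j \<le> 2 * n" using assms D_le[of m] by auto
  then have "n + j \<in> \<pi> m ` A" using ex_at_position[of "n + j" m] by (metis image_eqI)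
  then show "E m j \<in> A" "\<pi> m (E m j) = n + j"
    unfolding E_def by (auto intro: inv_into_into f_inv_into_f)
qed

lemma E_crosses:
  assumes "j \<in> {1..D m}" shows "crosses m (E m j)"
  using crosses_iff_after[OF E_in[OF assms], of m] E_position[OF assms] assms by simp

lemma E_position_before:
  assumes "j \<in> {1..D m}" shows "\<pi> (m - 1) (E m j) + j = n + 1"
  using crosses_reflects[OF E_in[OF assms] E_crosses[OF assms]] E_position[OF assms] by linarith

text \<open>
  The next crossing of \<open>E m j\<close> is at move \<open>m + 2 * n\<close>, the previous one at \<open>m - 2 * n\<close>.
\<close>

lemma E_right:
  assumes "j \<in> {1..D m}" "m \<le> i" "i < m + 2 * int n" shows "n < \<pi> i (E m j)"
proof -
  have e: "m + 2 * int n - 1 = (m - 1) + 2 * int n" by simp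
  have "n < \<pi> m (E m j)" "n < \<pi> (m + 2 * int n - 1) (E m j)"
    using E_position[OF assms(1)] E_position_before[OF assms(1)] assms(1)
      reversal[OF E_in[OF assms(1)], of "m - 1"] unfolding e by auto
  then show ?thesis
    using side_convex[OF E_in[OF assms(1)], of m i "m + 2 * int n - 1"] assms(2,3) by simp
qed

lemma E_left:
  assumes "j \<in> {1..D m}" "m - 2 * int n \<le> i" "i < m" shows "\<pi> i (E m j) \<le> n"
  using E_right[OF assms(1), of "i + 2 * int n"] reversal[OF E_in[OF assms(1)], of i] assms(2,3)
  by simp

text \<open>
  Two points of one crossing substring have met at \<open>m\<close>, so their order is constant until they meet
  again at \<open>m + 2 * n\<close>.
\<close>

lemma E_order_right:
  assumes "1 \<le> j" "j < j'" "j' \<le> D m" "m \<le> i" "i < m + 2 * int n"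
  shows "\<pi> i (E m j) < \<pi> i (E m j')"
proof -
  have j: "j \<in> {1..D m}" "j' \<in> {1..D m}" using assms by auto
  have e: "m + 2 * int n - 1 = (m - 1) + 2 * int n" by simp
  have "\<pi> m (E m j) < \<pi> m (E m j')"
    using E_position j assms(2) by simp
  moreover have "\<pi> (m + 2 * int n - 1) (E m j) < \<pi> (m + 2 * int n - 1) (E m j')"
    using E_position_before[OF j(1)] E_position_before[OF j(2)] assms(2)
      reversal[OF E_in[OF j(1)], of "m - 1"] reversal[OF E_in[OF j(2)], of "m - 1"]
    unfolding e by linarith
  ultimately show ?thesis
    using order_convex[OF E_in[OF j(1)] E_in[OF j(2)], of m i "m + 2 * int n - 1"] assms(4,5)
    by simp
qed

lemma E_order_left:
  assumes "1 \<le> j" "j < j'" "j' \<le> D m" "m - 2 * int n \<le> i" "i < m"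
  shows "\<pi> i (E m j') < \<pi> i (E m j)"
proof -
  have j: "j \<in> {1..D m}" "j' \<in> {1..D m}" using assms by auto
  show ?thesis
    using E_order_right[OF assms(1-3), of "i + 2 * int n"] assms(4,5)
      reversal[OF E_in[OF j(1)], of i] reversal[OF E_in[OF j(2)], of i] by linarith
qed

lemma antipode_eq_iff: "p \<in> A \<Longrightarrow> q \<in> A \<Longrightarrow> antipode p = antipode q \<longleftrightarrow> p = q"
  by (metis antipode_position position_inj add_right_cancel)

lemma antipode_antipode: "p \<in> A \<Longrightarrow> antipode (antipode p) = p"
  using antipode_position[of p 0] antipode_position[of "antipode p" 0] antipode_in
    position_inj[of "antipode (antipode p)" p 0] by auto

lemma E_shift:
  assumes "j \<in> {1..D m}" shows "E (m + 2 * int n) j = antipode (E m j)"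
proof -
  have j: "j \<in> {1..D (m + 2 * int n)}" using assms by (simp add: D_periodic)
  have "\<pi> (m + 2 * int n) (E (m + 2 * int n) j) = \<pi> (m + 2 * int n) (antipode (E m j))"
    using E_position[OF j] E_position[OF assms] reversal[OF E_in[OF assms], of m]
      antipode_position[OF E_in[OF assms], of "m + 2 * int n"] by linarith
  then show ?thesis using position_inj E_in[OF j] antipode_in[OF E_in[OF assms]] by blast
qed

lemma ex_E:
  assumes "p \<in> A"
  shows "\<exists>l j. m < l \<and> l \<le> m + 2 * int n \<and> j \<in> {1..D l} \<and> (p = E l j \<or> p = antipode (E l j))"
proof -
  obtain l where l: "m < l" "l \<le> m + 2 * int n" "crosses l p"
    using ex_crossing[OF assms] by blast
  have r: "n + 1 \<le> \<pi> l p + D l \<and> \<pi> l p \<le> n + D l"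
    using l crosses_iff_after[OF assms] by blast
  show ?thesis
  proof (cases "n < \<pi> l p")
    case True
    then have j: "\<pi> l p - n \<in> {1..D l}" using r by auto
    then have "p = E l (\<pi> l p - n)"
      using position_inj[OF assms E_in[OF j], of l] E_position[OF j] True by simp
    then show ?thesis using l j by blast
  next
    case False
    then have j: "n + 1 - \<pi> l p \<in> {1..D l}" using r by auto
    then have "p = antipode (E l (n + 1 - \<pi> l p))"
      using position_inj[OF assms antipode_in[OF E_in[OF j]], of l] E_position[OF j] False
        antipode_position[OF E_in[OF j], of l] by linarith
    then show ?thesis using l j by blast
  qed
qed

lemma E_inj:
  assumes "j \<in> {1..D l}" "j' \<in> {1..D l'}" "E l j = E l' j'" "\<bar>l - l'\<bar> < 2 * int n"
  shows "l = l'" "j = j'"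
proof -
  have "crosses l (E l j)" "crosses l' (E l j)"
    using E_crosses[OF assms(1)] E_crosses[OF assms(2)] by (simp_all only: assms(3))
  then have "\<not> l < l'" "\<not> l' < l"
    using crosses_separated[OF E_in[OF assms(1)], of l l'] assms(4)
      crosses_separated[OF E_in[OF assms(1)], of l' l] by linarith+
  then show "l = l'" by simp
  have "n + j = \<pi> l (E l' j')" using E_position[OF assms(1)] unfolding assms(3) by (rule sym)
  also have "\<dots> = n + j'" using E_position[OF assms(2)] unfolding \<open>l = l'\<close> .
  finally show "j = j'" by simp
qed

section \<open>Passing times\<close>

text \<open>
  For \<open>m \<le> i < m'\<close> the point \<open>E m j\<close> is in the right half and \<open>E m' j'\<close> in the left one, so it is the
  conjugate of the latter that \<open>E m j\<close> meets in the right half.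
\<close>

definition T :: "int \<Rightarrow> nat \<Rightarrow> int \<Rightarrow> nat \<Rightarrow> int" where
  "T m j m' j' = (THE i. m < i \<and> i < m' \<and> flips i (E m j) (antipode (E m' j')))"

definition meet :: "int \<Rightarrow> nat \<Rightarrow> int \<Rightarrow> nat \<Rightarrow> bool" where
  "meet m j m' j' \<longleftrightarrow> m < m' \<and> m' < m + 2 * int n \<and> j \<in> {1..D m} \<and> j' \<in> {1..D m'}"

text \<open>
  At \<open>m\<close> the point \<open>E m j\<close> is in the central substring, to which the other point does not belong
  as it crosses at \<open>m'\<close>; before \<open>m'\<close> the roles are exchanged.
\<close>

lemma meet_ends:
  assumes "meet m j m' j'"
  shows "\<pi> m (E m j) < \<pi> m (antipode (E m' j'))"
    and "\<pi> (m' - 1) (antipode (E m' j')) < \<pi> (m' - 1) (E m j)"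
proof -
  have less: "m < m'" "m' < m + 2 * int n" and j: "j \<in> {1..D m}" and j': "j' \<in> {1..D m'}"
    using assms by (auto simp: meet_def)
  have in': "antipode (E m' j') \<in> A" by (rule antipode_in[OF E_in[OF j']])
  have right: "n < \<pi> i (antipode (E m' j'))" if "m' - 2 * int n \<le> i" "i < m'" for i
    using E_left[OF j' that] antipode_position[OF E_in[OF j'], of i] by linarith
  have "\<not> crosses m (antipode (E m' j'))"
    using right[of m] right[of "m - 1"] less by (simp add: crosses_def)
  then show "\<pi> m (E m j) < \<pi> m (antipode (E m' j'))"
    using crosses_iff_after[OF in', of m] E_position[OF j] j right[of m] less by auto
  have "\<not> crosses m' (E m j)"
    using E_right[OF j, of m'] E_right[OF j, of "m' - 1"] less by (simp add: crosses_def)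
  then have "n + D m' < \<pi> (m' - 1) (E m j)"
    using crosses_iff_before[OF E_in[OF j], of m'] E_right[OF j, of "m' - 1"] less by auto
  then show "\<pi> (m' - 1) (antipode (E m' j')) < \<pi> (m' - 1) (E m j)"
    using E_position_before[OF j'] antipode_position[OF E_in[OF j'], of "m' - 1"] j' by auto
qed

lemma meet_in:
  assumes "meet m j m' j'" shows "E m j \<in> A" "antipode (E m' j') \<in> A" "E m' j' \<in> A"
  using assms E_in antipode_in by (auto simp: meet_def)

lemma T_eqI:
  assumes "meet m j m' j'" "m < i" "i < m'" "flips i (E m j) (antipode (E m' j'))"
  shows "T m j m' j' = i"
  unfolding T_def
proof (rule the_equality)
  fix x assume x: "m < x \<and> x < m' \<and> flips x (E m j) (antipode (E m' j'))"
  have "m' < m + 2 * int n" using assms(1) by (simp add: meet_def)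
  then have "\<not> x < i" "\<not> i < x"
    using flips_separated[OF meet_in(1,2)[OF assms(1)], of x i]
      flips_separated[OF meet_in(1,2)[OF assms(1)], of i x] x assms(2-4) by auto
  then show "x = i" by simp
qed (use assms in blast)

lemma T:
  assumes "meet m j m' j'"
  shows T_range: "m < T m j m' j'" "T m j m' j' < m'"
    and T_flips: "flips (T m j m' j') (E m j) (antipode (E m' j'))"
proof -
  obtain i where i: "m < i" "i \<le> m' - 1" "flips i (E m j) (antipode (E m' j'))"
    using order_change_flips[of m "m' - 1" "E m j" "antipode (E m' j')"] meet_ends[OF assms] assms
    by (force simp: meet_def)
  then have "T m j m' j' = i" by (intro T_eqI[OF assms]) auto
  then show "m < T m j m' j'" "T m j m' j' < m'"
    "flips (T m j m' j') (E m j) (antipode (E m' j'))" using i by auto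
qed

lemma less_iff_before_T:
  assumes "meet m j m' j'" "m \<le> i" "i < m'"
  shows "\<pi> i (E m j) < \<pi> i (antipode (E m' j')) \<longleftrightarrow> i < T m j m' j'"
proof
  assume lt: "\<pi> i (E m j) < \<pi> i (antipode (E m' j'))"
  then obtain x where x: "i < x" "x \<le> m' - 1" "flips x (E m j) (antipode (E m' j'))"
    using order_change_flips[of i "m' - 1" "E m j" "antipode (E m' j')"] meet_ends[OF assms(1)] assms
    by force
  then have "T m j m' j' = x" using assms by (intro T_eqI[OF assms(1)]) auto
  then show "i < T m j m' j'" using x by simp
next
  assume lt: "i < T m j m' j'"
  show "\<pi> i (E m j) < \<pi> i (antipode (E m' j'))"
  proof (rule ccontr)
    assume "\<not> \<pi> i (E m j) < \<pi> i (antipode (E m' j'))"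
    then obtain x where x: "m < x" "x \<le> i" "flips x (E m j) (antipode (E m' j'))"
      using order_change_flips[of m i "E m j" "antipode (E m' j')"] meet_ends[OF assms(1)] assms
      by force
    then have "T m j m' j' = x" using assms by (intro T_eqI[OF assms(1)]) auto
    then show False using x lt by simp
  qed
qed

lemma T_transposes:
  assumes "meet m j m' j'" and "\<tau> = T m j m' j'"
  shows "\<pi> (\<tau> - 1) (antipode (E m' j')) = \<pi> (\<tau> - 1) (E m j) + 1"
    and "\<pi> \<tau> (E m j) = \<pi> (\<tau> - 1) (E m j) + 1"
    and "\<pi> \<tau> (antipode (E m' j')) = \<pi> (\<tau> - 1) (E m j)"
proof -
  have r: "m < \<tau>" "\<tau> < m'" using T_range[OF assms(1)] assms(2) by auto
  have m: "m' < m + 2 * int n" "j \<in> {1..D m}" using assms(1) by (auto simp: meet_def)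
  have "\<not> crosses \<tau> (E m j)"
    using E_right[OF m(2), of \<tau>] E_right[OF m(2), of "\<tau> - 1"] r m(1) by (simp add: crosses_def)
  moreover have "\<pi> (\<tau> - 1) (E m j) < \<pi> (\<tau> - 1) (antipode (E m' j'))"
    using less_iff_before_T[OF assms(1), of "\<tau> - 1"] assms(2) r by simp
  ultimately show "\<pi> (\<tau> - 1) (antipode (E m' j')) = \<pi> (\<tau> - 1) (E m j) + 1"
    "\<pi> \<tau> (E m j) = \<pi> (\<tau> - 1) (E m j) + 1"
    "\<pi> \<tau> (antipode (E m' j')) = \<pi> (\<tau> - 1) (E m j)"
    using flips_transposes[OF meet_in(1,2)[OF assms(1)]] T_flips[OF assms(1)] assms(2) by blast+
qed

text \<open>
  When \<open>E m j\<close> has passed the outer one of two points belonging to \<open>m'\<close>, it is also outside the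
  inner one, and it cannot pass both in the same move.
\<close>

lemma T_mono_right:
  assumes "meet m j m' j'" "meet m j m' j''" "j' < j''"
  shows "T m j m' j' < T m j m' j''"
proof -
  define \<tau> where "\<tau> = T m j m' j''"
  have r: "m < \<tau>" "\<tau> < m'" using T_range[OF assms(2)] by (auto simp: \<tau>_def)
  have less: "\<pi> i (antipode (E m' j')) < \<pi> i (antipode (E m' j''))"
    if "m \<le> i" "i < m'" for i
    using E_order_left[of j' j'' m' i] that assms
      antipode_position[OF meet_in(3)[OF assms(1)], of i]
      antipode_position[OF meet_in(3)[OF assms(2)], of i] by (force simp: meet_def)
  have "\<pi> \<tau> (antipode (E m' j'')) < \<pi> \<tau> (E m j)"
    using T_transposes[OF assms(2) \<tau>_def] by simp
  then have "\<not> \<tau> < T m j m' j'"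
    using less[of \<tau>] r less_iff_before_T[OF assms(1), of \<tau>] by simp
  moreover have "T m j m' j' \<noteq> \<tau>"
    using T_transposes(1)[OF assms(1), of \<tau>] T_transposes(1)[OF assms(2) \<tau>_def] less[of "\<tau> - 1"] r
    by auto
  ultimately show ?thesis by (simp add: \<tau>_def)
qed

lemma T_mono_left:
  assumes "meet m j m' j'" "meet m i m' j'" "j < i"
  shows "T m i m' j' < T m j m' j'"
proof -
  define \<tau> where "\<tau> = T m j m' j'"
  have r: "m < \<tau>" "\<tau> < m'" using T_range[OF assms(1)] by (auto simp: \<tau>_def)
  have less: "\<pi> x (E m j) < \<pi> x (E m i)" if "m \<le> x" "x < m'" for x
    using E_order_right[of j i m x] that assms by (force simp: meet_def)
  have "\<pi> \<tau> (antipode (E m' j')) < \<pi> \<tau> (E m j)"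
    using T_transposes[OF assms(1) \<tau>_def] by simp
  then have "\<not> \<tau> < T m i m' j'"
    using less[of \<tau>] r less_iff_before_T[OF assms(2), of \<tau>] by simp
  moreover have "T m i m' j' \<noteq> \<tau>"
    using T_transposes(1)[OF assms(2), of \<tau>] T_transposes(1)[OF assms(1) \<tau>_def] less[of "\<tau> - 1"] r
    by auto
  ultimately show ?thesis by (simp add: \<tau>_def)
qed

text \<open>
  A point takes part in at most one transposition of a move, so the partner is determined.
\<close>

lemma T_inj_right:
  assumes "meet m j l i" "meet m j l' i'" "T m j l i = T m j l' i'"
  shows "l = l'" "i = i'"
proof -
  have "antipode (E l i) = antipode (E l' i')"
    using T_transposes(1)[OF assms(1) assms(3)[symmetric]] T_transposes(1)[OF assms(2) refl]
      position_inj[OF meet_in(2)[OF assms(1)] meet_in(2)[OF assms(2)]] by metis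
  then have eq: "E l i = E l' i'"
    using antipode_eq_iff meet_in(3)[OF assms(1)] meet_in(3)[OF assms(2)] by blast
  have "\<bar>l - l'\<bar> < 2 * int n" "i \<in> {1..D l}" "i' \<in> {1..D l'}"
    using assms(1,2) by (auto simp: meet_def)
  from E_inj[OF this(2,3) eq this(1)] show "l = l'" "i = i'" .
qed

lemma T_inj_left:
  assumes "meet l i m j" "meet l' i' m j" "T l i m j = T l' i' m j"
  shows "l = l'" "i = i'"
proof -
  have eq: "E l i = E l' i'"
    using T_transposes(1)[OF assms(1) assms(3)[symmetric]] T_transposes(1)[OF assms(2) refl]
      position_inj[OF meet_in(1)[OF assms(1)] meet_in(1)[OF assms(2)]] by (metis add_right_cancel)
  have "\<bar>l - l'\<bar> < 2 * int n" "i \<in> {1..D l}" "i' \<in> {1..D l'}"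
    using assms(1,2) by (auto simp: meet_def)
  from E_inj[OF this(2,3) eq this(1)] show "l = l'" "i = i'" .
qed

section \<open>Equality in the gaps and in the passing times\<close>

definition S :: "int \<Rightarrow> int \<Rightarrow> nat" where
  "S m m' = sum D {m<..<m'}"

lemma S_split:
  assumes "m < l" "l < m'" shows "S m m' = S m l + D l + S l m'"
proof -
  have "{m<..<m'} = {m<..<l} \<union> ({l} \<union> {l<..<m'})" using assms by auto
  then have "S m m' = sum D {m<..<l} + sum D ({l} \<union> {l<..<m'})"
    unfolding S_def by (simp only:) (rule sum.union_disjoint, auto)
  also have "sum D ({l} \<union> {l<..<m'}) = D l + sum D {l<..<m'}" by simp
  finally show ?thesis by (simp add: S_def)
qed

lemma S_full: "S m (m + 2 * int n) + D m = n"
proof -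
  have "{m<..m + 2 * int n} = insert (m + 2 * int n) {m<..<m + 2 * int n}"
    using n_pos by auto
  then show ?thesis using sum_D[of m] by (simp add: S_def D_periodic)
qed

lemma T_bounds:
  assumes "meet m j m' j'"
  shows "T m (D m) m' 1 + int (D m - j) + int (j' - 1) \<le> T m j m' j'"
    and "T m j m' j' + int (j - 1) + int (D m' - j') \<le> T m 1 m' (D m')"
proof -
  have mm: "m < m'" "m' < m + 2 * int n" and j: "1 \<le> j" "j \<le> D m" "1 \<le> j'" "j' \<le> D m'"
    using assms by (auto simp: meet_def)
  have meets: "meet m i m' i'" if "1 \<le> i" "i \<le> D m" "1 \<le> i'" "i' \<le> D m'" for i i'
    using that mm by (simp add: meet_def)
  have right: "T m i m' i' + int k \<le> T m i m' (i' + k)"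
    if "1 \<le> i" "i \<le> D m" "1 \<le> i'" "i' + k \<le> D m'" for i i' k
    using that(4)
  proof (induction k)
    case (Suc k)
    then show ?case using T_mono_right[of m i m' "i' + k" "i' + Suc k"] meets that by fastforce
  qed simp
  have left: "T m (i + k) m' i' + int k \<le> T m i m' i'"
    if "1 \<le> i" "i + k \<le> D m" "1 \<le> i'" "i' \<le> D m'" for i i' k
    using that(2)
  proof (induction k)
    case (Suc k)
    then show ?case using T_mono_left[of m "i + k" m' i' "i + Suc k"] meets that by fastforce
  qed simp
  show "T m (D m) m' 1 + int (D m - j) + int (j' - 1) \<le> T m j m' j'"
    using left[of j "D m - j" 1] right[of j 1 "j' - 1"] j by simp
  show "T m j m' j' + int (j - 1) + int (D m' - j') \<le> T m 1 m' (D m')"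
    using left[of 1 "j - 1" "D m'"] right[of j j' "D m' - j'"] j by simp
qed

text \<open>
  For neighbouring crossing moves, the \<open>D m * D m'\<close> passings need \<open>D m + D m' - 1\<close> different moves by
  strict monotonicity. Otherwise an intermediate crossing move splits the gap into two.
\<close>

lemma gap_lower_bound:
  assumes "m < m'" "m' < m + 2 * int n" "0 < D m" "0 < D m'"
  shows "int (D m + 2 * S m m' + D m') \<le> m' - m"
  using assms
proof (induction "nat (m' - m)" arbitrary: m m' rule: less_induct)
  case less
  show ?case
  proof (cases "\<exists>l. m < l \<and> l < m' \<and> 0 < D l")
    case True
    then obtain l where l: "m < l" "l < m'" "0 < D l" by blast
    have "int (D m + 2 * S m l + D l) \<le> l - m" "int (D l + 2 * S l m' + D m') \<le> m' - l"
      using less l by (auto intro!: less.hyps)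
    then show ?thesis using S_split[OF l(1,2)] by simp
  next
    case False
    then have S0: "S m m' = 0" unfolding S_def by simp
    have meets: "meet m (D m) m' 1" "meet m 1 m' 1" "meet m 1 m' (D m')"
      using less.prems by (auto simp: meet_def)
    have "T m (D m) m' 1 + int (D m - 1) \<le> T m 1 m' 1" using T_bounds(1)[OF meets(2)] by simp
    moreover have "T m 1 m' 1 + int (D m' - 1) \<le> T m 1 m' (D m')"
      using T_bounds(2)[OF meets(2)] by simp
    moreover have "m < T m (D m) m' 1" "T m 1 m' (D m') < m'"
      using T_range meets by blast+
    ultimately show ?thesis using S0 less.prems by simp
  qed
qed

text \<open>
  The gaps from \<open>m\<close> to \<open>m'\<close> and from \<open>m'\<close> to \<open>m + 2 * n\<close> together have length \<open>2 * n\<close>, which is also the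
  sum of their lower bounds.
\<close>

lemma gap:
  assumes "m < m'" "m' < m + 2 * int n" "0 < D m" "0 < D m'"
  shows "m' - m = int (D m + 2 * S m m' + D m')"
proof -
  have "int (D m + 2 * S m m' + D m') \<le> m' - m" by (rule gap_lower_bound[OF assms])
  moreover have "int (D m' + 2 * S m' (m + 2 * int n) + D m) \<le> m + 2 * int n - m'"
    using gap_lower_bound[of m' "m + 2 * int n"] assms by (simp add: D_periodic)
  moreover have "S m m' + D m' + S m' (m + 2 * int n) + D m = n"
    using S_full[of m] S_split[OF assms(1,2)] by simp
  ultimately show ?thesis by linarith
qed

abbreviation points_between :: "int \<Rightarrow> int \<Rightarrow> (int \<times> nat) set" where
  "points_between m m' \<equiv> Sigma {m<..<m'} (\<lambda>l. {1..D l})"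

lemma S_prefix: "m < l \<Longrightarrow> l < m' \<Longrightarrow> S m l + D l \<le> S m m'"
  using S_split[of m l m'] by simp

lemma S_suffix: "m < l \<Longrightarrow> l < m' \<Longrightarrow> S l m' + D l \<le> S m m'"
  using S_split[of m l m'] by simp

text \<open>
  Both in the induction for \<open>T_eq\<close>, where the formula is known for smaller gaps only, and afterwards
  for the whole stay of a point in the right half, injective passing times that lie in an interval
  of the right length must exhaust it.
\<close>

lemma passings_outward_fill:
  assumes m: "j \<in> {1..D m}" "m' \<le> m + 2 * int n"
    and val: "\<And>l i. m < l \<Longrightarrow> l < m' \<Longrightarrow> i \<in> {1..D l} \<Longrightarrow>
      T m j l i = m + int (D m) - int j + int (S m l) + int i"
  shows "(\<lambda>(l, i). T m j l i) ` points_between m m' =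
    {m + int (D m) - int j + 1..m + int (D m) - int j + int (S m m')}"
proof (rule card_subset_eq)
  have meets: "meet m j l i" if "(l, i) \<in> points_between m m'" for l i
    using that m by (auto simp: meet_def)
  have "inj_on (\<lambda>(l, i). T m j l i) (points_between m m')"
  proof (rule inj_onI, clarify)
    fix l i l' i' assume li: "l \<in> {m<..<m'}" "i \<in> {1..D l}" "l' \<in> {m<..<m'}" "i' \<in> {1..D l'}"
      and eq: "T m j l i = T m j l' i'"
    have "meet m j l i" "meet m j l' i'" using meets li by blast+
    from T_inj_right[OF this eq] show "l = l' \<and> i = i'" by blast
  qed
  then show "card ((\<lambda>(l, i). T m j l i) ` points_between m m') =
    card {m + int (D m) - int j + 1..m + int (D m) - int j + int (S m m')}"
    by (simp add: card_image S_def flip: of_nat_sum)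
  show "(\<lambda>(l, i). T m j l i) ` points_between m m' \<subseteq>
    {m + int (D m) - int j + 1..m + int (D m) - int j + int (S m m')}"
  proof clarify
    fix l i assume li: "l \<in> {m<..<m'}" "i \<in> {1..D l}"
    then show "T m j l i \<in> {m + int (D m) - int j + 1..m + int (D m) - int j + int (S m m')}"
      using val[of l i] S_prefix[of m l m'] by auto
  qed
qed simp

lemma passings_inward_fill:
  assumes m: "j' \<in> {1..D m'}" "m' - 2 * int n \<le> m"
    and val: "\<And>l i. m < l \<Longrightarrow> l < m' \<Longrightarrow> i \<in> {1..D l} \<Longrightarrow>
      T l i m' j' = l + int (D l) - int i + int (S l m') + int j'"
  shows "(\<lambda>(l, i). T l i m' j') ` points_between m m' =
    {m' - int (D m') + int j' - int (S m m')..m' - int (D m') + int j' - 1}"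
proof (rule card_subset_eq)
  have meets: "meet l i m' j'" if "(l, i) \<in> points_between m m'" for l i
    using that m by (auto simp: meet_def)
  have "inj_on (\<lambda>(l, i). T l i m' j') (points_between m m')"
  proof (rule inj_onI, clarify)
    fix l i l' i' assume li: "l \<in> {m<..<m'}" "i \<in> {1..D l}" "l' \<in> {m<..<m'}" "i' \<in> {1..D l'}"
      and eq: "T l i m' j' = T l' i' m' j'"
    have "meet l i m' j'" "meet l' i' m' j'" using meets li by blast+
    from T_inj_left[OF this eq] show "l = l' \<and> i = i'" by blast
  qed
  then show "card ((\<lambda>(l, i). T l i m' j') ` points_between m m') =
    card {m' - int (D m') + int j' - int (S m m')..m' - int (D m') + int j' - 1}"
    by (simp add: card_image S_def flip: of_nat_sum)
  show "(\<lambda>(l, i). T l i m' j') ` points_between m m' \<subseteq>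
    {m' - int (D m') + int j' - int (S m m')..m' - int (D m') + int j' - 1}"
  proof clarify
    fix l i assume li: "l \<in> {m<..<m'}" "i \<in> {1..D l}"
    then have "m' - l = int (D l + 2 * S l m' + D m')"
      using gap[of l m'] m by auto
    then show "T l i m' j' \<in> {m' - int (D m') + int j' - int (S m m')..m' - int (D m') + int j' - 1}"
      using val[of l i] S_suffix[of m l m'] li by auto
  qed
qed simp

text \<open>
  The outermost point \<open>E m (D m)\<close> is busy during the \<open>S m m'\<close> moves after \<open>m\<close>, and the partner
  \<open>E m' (D m')\<close> during the \<open>S m m'\<close> moves before \<open>m'\<close>. The room left between is just enough for the
  strictly monotone passing times.
\<close>

lemma T_eq:
  assumes "meet m j m' j'"
  shows "T m j m' j' = m + int (D m) - int j + int (S m m') + int j'"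
  using assms
proof (induction "nat (m' - m)" arbitrary: m m' j j' rule: less_induct)
  case less
  have mm: "m < m'" "m' < m + 2 * int n" and j: "1 \<le> j" "j \<le> D m" "1 \<le> j'" "j' \<le> D m'"
    using less.prems by (auto simp: meet_def)
  have meets: "meet m (D m) m' 1" "meet m 1 m' (D m')"
    using mm j by (auto simp: meet_def)
  have "(\<lambda>(l, i). T m (D m) l i) ` points_between m m' =
    {m + int (D m) - int (D m) + 1..m + int (D m) - int (D m) + int (S m m')}"
  proof (rule passings_outward_fill)
    fix l i assume li: "m < l" "l < m'" "i \<in> {1..D l}"
    then show "T m (D m) l i = m + int (D m) - int (D m) + int (S m l) + int i"
      using mm j by (intro less.hyps) (auto simp: meet_def)
  qed (use mm j in auto)
  moreover have "T m (D m) m' 1 \<notin> (\<lambda>(l, i). T m (D m) l i) ` points_between m m'"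
  proof clarify
    fix l i assume li: "T m (D m) m' 1 = T m (D m) l i" "l \<in> {m<..<m'}" "i \<in> {1..D l}"
    then have "meet m (D m) l i" using mm j by (auto simp: meet_def)
    from T_inj_right(1)[OF meets(1) this li(1)] li(2) show False by simp
  qed
  ultimately have lower: "m + int (S m m') < T m (D m) m' 1"
    using T_range(1)[OF meets(1)] by auto
  have "(\<lambda>(l, i). T l i m' (D m')) ` points_between m m' =
    {m' - int (D m') + int (D m') - int (S m m')..m' - int (D m') + int (D m') - 1}"
  proof (rule passings_inward_fill)
    fix l i assume li: "m < l" "l < m'" "i \<in> {1..D l}"
    then show "T l i m' (D m') = l + int (D l) - int i + int (S l m') + int (D m')"
      using mm j by (intro less.hyps) (auto simp: meet_def)
  qed (use mm j in auto)
  moreover have "T m 1 m' (D m') \<notin> (\<lambda>(l, i). T l i m' (D m')) ` points_between m m'"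
  proof clarify
    fix l i assume li: "T m 1 m' (D m') = T l i m' (D m')" "l \<in> {m<..<m'}" "i \<in> {1..D l}"
    then have "meet l i m' (D m')" using mm j by (auto simp: meet_def)
    from T_inj_left(1)[OF meets(2) this li(1)] li(2) show False by simp
  qed
  ultimately have upper: "T m 1 m' (D m') < m' - int (S m m')"
    using T_range(2)[OF meets(2)] by auto
  have "m' - m = int (D m + 2 * S m m' + D m')" using gap mm j by simp
  then show ?case
    using lower upper T_bounds[OF less.prems] j by linarith
qed

section \<open>Paths\<close>

lemma step_outward:
  assumes j: "j \<in> {1..D m}"
    and \<tau>: "m + int (D m) - int j < \<tau>" "\<tau> \<le> m + int (D m) - int j + int (n - D m)"
  shows "\<pi> \<tau> (E m j) = \<pi> (\<tau> - 1) (E m j) + 1"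
proof -
  have "(\<lambda>(l, i). T m j l i) ` points_between m (m + 2 * int n) =
    {m + int (D m) - int j + 1..m + int (D m) - int j + int (S m (m + 2 * int n))}"
    by (rule passings_outward_fill) (use j in \<open>auto simp: meet_def intro!: T_eq\<close>)
  moreover have "S m (m + 2 * int n) = n - D m" using S_full[of m] by simp
  ultimately have "\<tau> \<in> (\<lambda>(l, i). T m j l i) ` points_between m (m + 2 * int n)"
    using \<tau> by simp
  then obtain l i where li: "\<tau> = T m j l i" "m < l" "l < m + 2 * int n" "i \<in> {1..D l}"
    by auto
  then have "meet m j l i" using j by (simp add: meet_def)
  from T_transposes(2)[OF this li(1)] show ?thesis .
qed

text \<open>
  On its way back \<open>E m j\<close> is the conjugate of \<open>E (m + 2 * n) j\<close> and is passed by the points that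
  crossed after it.
\<close>

lemma step_inward:
  assumes j: "j \<in> {1..D m}"
    and \<tau>: "m + int n + int j \<le> \<tau>" "\<tau> < m + 2 * int n - int (D m) + int j"
  shows "\<pi> (\<tau> - 1) (E m j) = \<pi> \<tau> (E m j) + 1"
proof -
  let ?m' = "m + 2 * int n"
  have j': "j \<in> {1..D ?m'}" using j by (simp add: D_periodic)
  have "(\<lambda>(l, i). T l i ?m' j) ` points_between m ?m' =
    {?m' - int (D ?m') + int j - int (S m ?m')..?m' - int (D ?m') + int j - 1}"
    by (rule passings_inward_fill) (use j' in \<open>auto simp: meet_def intro!: T_eq\<close>)
  moreover have "S m ?m' + D m = n" by (rule S_full)
  ultimately have "\<tau> \<in> (\<lambda>(l, i). T l i ?m' j) ` points_between m ?m'"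
    using \<tau> by (simp add: D_periodic)
  then obtain l i where li: "\<tau> = T l i ?m' j" "m < l" "l < ?m'" "i \<in> {1..D l}"
    by auto
  then have "meet l i ?m' j" using j' by (simp add: meet_def)
  from T_transposes(1,3)[OF this li(1)] show ?thesis
    by (simp add: E_shift[OF j] antipode_antipode[OF E_in[OF j]])
qed

text \<open>
  Any other displacement would be an exchange with a point \<open>q\<close> in the right half, and \<open>q\<close> crosses
  once in the moves \<open>m + 1, \<dots>, m + 2 * n\<close>. If it does so after \<open>\<tau>\<close> but before \<open>m + 2 * n\<close>, the exchange
  is a passing on the way out, if before \<open>\<tau>\<close>, a passing on the way back. If it crosses at
  \<open>m + 2 * n\<close>, it belongs to the same crossing substring as \<open>E m j\<close>, and these points do not exchange.
\<close>

lemma step_idle: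
  assumes j: "j \<in> {1..D m}" and \<tau>: "m < \<tau>" "\<tau> < m + 2 * int n"
    and not_out: "\<not> (m + int (D m) - int j < \<tau> \<and> \<tau> \<le> m + int (D m) - int j + int (n - D m))"
    and not_in: "\<not> (m + int n + int j \<le> \<tau> \<and> \<tau> < m + 2 * int n - int (D m) + int j)"
  shows "\<pi> \<tau> (E m j) = \<pi> (\<tau> - 1) (E m j)"
proof (rule ccontr)
  assume moves: "\<pi> \<tau> (E m j) \<noteq> \<pi> (\<tau> - 1) (E m j)"
  let ?a = "E m j"
  note a = E_in[OF j]
  have right: "n < \<pi> \<tau> ?a" "n < \<pi> (\<tau> - 1) ?a" using E_right[OF j] \<tau> by auto
  then have nc: "\<not> crosses \<tau> ?a" by (simp add: crosses_def)
  obtain q where q: "q \<in> A" "q \<noteq> ?a" and f: "flips \<tau> ?a q"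
    using in_some_switch[OF a moves] switch_moves(1)[OF a nc] by blast
  \<comment> \<open>the partner of a point that stays right of the center cannot come from the left half\<close>
  have "n < \<pi> \<tau> q \<and> n < \<pi> (\<tau> - 1) q"
  proof (cases "\<pi> (\<tau> - 1) ?a < \<pi> (\<tau> - 1) q")
    case True
    then show ?thesis using flips_transposes[OF a q(1) f nc] right by simp
  next
    case False
    then have less: "\<pi> (\<tau> - 1) q < \<pi> (\<tau> - 1) ?a"
      using position_inj[OF q(1) a, of "\<tau> - 1"] q(2) by linarith
    have f': "flips \<tau> q ?a" using f flips_sym[OF a q(1)] by simp
    then have "\<pi> \<tau> ?a < \<pi> \<tau> q"
      using less position_inj[OF q(1) a, of \<tau>] q(2) by (simp add: flips_def)
    then have "n < \<pi> \<tau> q" using right by simp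
    moreover have "n < \<pi> (\<tau> - 1) q"
    proof (cases "crosses \<tau> q")
      case True
      then have "\<pi> \<tau> q \<le> n + D \<tau>" using crosses_iff_after[OF q(1)] by blast
      then have "crosses \<tau> ?a"
        using crosses_iff_after[OF a, of \<tau>] \<open>\<pi> \<tau> ?a < \<pi> \<tau> q\<close> right by simp
      then show ?thesis using nc by simp
    qed (use \<open>n < \<pi> \<tau> q\<close> in \<open>simp add: crosses_def\<close>)
    ultimately show ?thesis by simp
  qed
  then have q_right: "n < \<pi> \<tau> q" "n < \<pi> (\<tau> - 1) q" by auto
  obtain l i where li: "m < l" "l \<le> m + 2 * int n" "i \<in> {1..D l}"
    and q_eq: "q = E l i \<or> q = antipode (E l i)"
    using ex_E[OF q(1), of m] by blast
  note e = E_in[OF li(3)]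
  consider "l = m + 2 * int n" | "l < m + 2 * int n" "\<tau> < l" | "l < m + 2 * int n" "l < \<tau>"
    | "\<tau> = l" using li(2) by linarith
  then show False
  proof cases
    case 1
    then have i: "i \<in> {1..D m}" using li(3) by (simp add: D_periodic)
    have "E l i = antipode (E m i)" using E_shift[OF i] 1 by simp
    then have "q = E m i \<or> q = antipode (E m i)"
      using q_eq antipode_antipode[OF E_in[OF i]] by auto
    moreover have "n < \<pi> \<tau> (E m i)" using E_right[OF i] \<tau> by simp
    ultimately have q': "q = E m i"
      using antipode_position[OF E_in[OF i], of \<tau>] q_right(1) by auto
    then have "i \<noteq> j" using q(2) by auto
    then have "i < j \<or> j < i" by linarith
    then have "\<not> flips \<tau> ?a q"
      using E_order_right[of i j m] E_order_right[of j i m] i j \<tau> unfolding q' flips_def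
      by (smt (verit) atLeastAtMost_iff not_less_iff_gr_or_eq)
    then show False using f by simp
  next
    case 2
    have "\<pi> \<tau> (E l i) \<le> n" using E_left[OF li(3)] 2 \<tau> by simp
    then have "q = antipode (E l i)" using q_eq q_right(1) by auto
    moreover have meet: "meet m j l i" using j li 2 by (simp add: meet_def)
    ultimately have "T m j l i = \<tau>" using T_eqI[OF meet] f \<tau> 2 by simp
    moreover have "S m l + D l \<le> S m (m + 2 * int n)" using S_prefix li(1) 2 by simp
    ultimately show False using T_eq[OF meet] S_full[of m] not_out li(3) by auto
  next
    case 3
    have "n < \<pi> \<tau> (E l i)" using E_right[OF li(3)] 3 \<tau> li by simp
    then have q': "q = E l i"
      using q_eq q_right(1) antipode_position[OF e, of \<tau>] by auto
    have meet: "meet l i (m + 2 * int n) j" using j li 3 by (simp add: meet_def D_periodic)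
    have "flips \<tau> (E l i) (antipode (E (m + 2 * int n) j))"
      using f flips_sym[OF a q(1)] q' by (simp add: E_shift[OF j] antipode_antipode[OF a])
    then have "T l i (m + 2 * int n) j = \<tau>" using T_eqI[OF meet] \<tau> 3 by simp
    moreover have "m + 2 * int n - l = int (D l + 2 * S l (m + 2 * int n) + D m)"
      using gap[of l "m + 2 * int n"] li 3 j by (simp add: D_periodic)
    moreover have "S l (m + 2 * int n) + D l \<le> S m (m + 2 * int n)"
      using S_suffix li(1) 3 by simp
    ultimately show False using T_eq[OF meet] S_full[of m] not_in li(3) by auto
  next
    case 4
    then have "crosses \<tau> (E l i)" using E_crosses[OF li(3)] by simp
    moreover have "crosses \<tau> (antipode (E l i)) \<longleftrightarrow> crosses \<tau> (E l i)"
      using antipode_position[OF e, of \<tau>] antipode_position[OF e, of "\<tau> - 1"]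
      unfolding crosses_def by linarith
    ultimately have "crosses \<tau> q" using q_eq by auto
    then show False using q_right by (simp add: crosses_def)
  qed
qed

lemma letter_after:
  assumes j: "j \<in> {1..D m}" and \<tau>: "m < \<tau>" "\<tau> < m + 2 * int n"
  shows "path_letter A \<pi> (E m j) \<tau> =
    (if m + int (D m) - int j < \<tau> \<and> \<tau> \<le> m + int (D m) - int j + int (n - D m) then R
     else if m + int n + int j \<le> \<tau> \<and> \<tau> < m + 2 * int n - int (D m) + int j then L
     else P)"
proof -
  have "\<not> crosses \<tau> (E m j)"
    using E_right[OF j, of \<tau>] E_right[OF j, of "\<tau> - 1"] \<tau> by (simp add: crosses_def)
  then show ?thesis
    using step_outward[OF j, of \<tau>] step_inward[OF j, of \<tau>] step_idle[OF j \<tau>]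
    by (simp add: path_letter_eq[OF E_in[OF j]])
qed

lemma letter_antipode:
  assumes "p \<in> A"
  shows "path_letter A \<pi> (antipode p) i =
    (case path_letter A \<pi> p i of R \<Rightarrow> L | L \<Rightarrow> R | x \<Rightarrow> x)"
proof -
  note pos = antipode_position[OF assms, of i] antipode_position[OF assms, of "i - 1"]
  have "crosses i (antipode p) \<longleftrightarrow> crosses i p"
    using pos unfolding crosses_def by linarith
  moreover have "\<pi> i (antipode p) = \<pi> (i - 1) (antipode p) \<longleftrightarrow> \<pi> i p = \<pi> (i - 1) p"
    "\<pi> (i - 1) (antipode p) < \<pi> i (antipode p) \<longleftrightarrow> \<pi> i p < \<pi> (i - 1) p"
    using pos by linarith+
  ultimately show ?thesis
    by (simp add: path_letter_eq[OF assms] path_letter_eq[OF antipode_in[OF assms]])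
qed

text \<open>
  Before its crossing at \<open>m\<close>, the point \<open>E m j\<close> is the conjugate of \<open>E (m - 2 * n) j\<close>, whose path is
  mirrored.
\<close>

lemma letter_before:
  assumes j: "j \<in> {1..D m}" and \<tau>: "m - 2 * int n < \<tau>" "\<tau> < m"
  shows "path_letter A \<pi> (E m j) \<tau> =
    (if m - 2 * int n + int (D m) - int j < \<tau>
        \<and> \<tau> \<le> m - 2 * int n + int (D m) - int j + int (n - D m) then L
     else if m - int n + int j \<le> \<tau> \<and> \<tau> < m - int (D m) + int j then R
     else P)"
proof -
  have D: "D (m - 2 * int n) = D m" using D_periodic[of "m - 2 * int n"] by simp
  have j': "j \<in> {1..D (m - 2 * int n)}" using j D by simp
  have "E m j = antipode (E (m - 2 * int n) j)" using E_shift[OF j'] by simp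
  then show ?thesis
    using letter_antipode[OF E_in[OF j'], of \<tau>] letter_after[OF j', of \<tau>] \<tau> D by simp
qed

lemma letter_at:
  assumes "j \<in> {1..D m}" shows "path_letter A \<pi> (E m j) m = C"
  using E_crosses[OF assms] by (simp add: path_letter_eq[OF E_in[OF assms]])

text \<open>
  The condition \<open>\<delta> = 0 \<or> d \<le> \<delta>\<close> guarantees that the rest of \<open>k - 1\<close> moves before the crossing is not cut off
  at the start of the halfperiod, except at the very first move, where nothing precedes; the
  bound \<open>\<delta> + d \<le> 2 * n\<close> does the same for the rest after the crossing. The cases tell which of the
  outward and inward runs on the two sides are cut off.
\<close>

lemma path_E:
  fixes \<delta> :: nat
  assumes m: "m = int \<delta> + 1" and k: "1 \<le> k" "k \<le> d" and d: "d = D m"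
    and \<delta>: "\<delta> = 0 \<or> d \<le> \<delta>" "\<delta> + d \<le> 2 * n"
  shows "path A \<pi> (E m (d + 1 - k)) =
        (if \<delta> = 0 \<and> 2 \<le> k then
           [C] @ P\<up>(k - 1) @ R\<up>(n - d) @ P\<up>(2 * (d - k) + 1) @ L\<up>(n - d) @ P\<up>(k - 1)
         else if int d - int k < int n - int \<delta> then
           R\<up>(\<delta> + 1 - k) @ P\<up>(k - 1) @ [C] @ P\<up>(k - 1) @ R\<up>(n - d)
             @ P\<up>(2 * (d - k) + 1) @ L\<up>(n + k - (d + \<delta> + 1))
         else if int d - int k \<ge> \<bar>int \<delta> - int n\<bar> then
           P\<up>(d + \<delta> + 1 - (k + n)) @ R\<up>(n - d) @ P\<up>(k - 1) @ [C] @ P\<up>(k - 1)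
             @ R\<up>(n - d) @ P\<up>(d + n - (k + \<delta>))
         else
           L\<up>(\<delta> + k - (n + d)) @ P\<up>(2 * (d - k) + 1) @ R\<up>(n - d) @ P\<up>(k - 1)
             @ [C] @ P\<up>(k - 1) @ R\<up>(2 * n - (\<delta> + k)))"
proof -
  define f where "f = path_letter A \<pi> (E m (d + 1 - k))"
  have j: "d + 1 - k \<in> {1..D m}" using k d by auto
  have d_le: "d \<le> n" using D_le[of m] d by simp
  have "f m = C" unfolding f_def by (rule letter_at[OF j])
  then have at: "f m = C" "f (1 + int \<delta>) = C" by (simp_all add: m add.commute)
  have after: "f \<tau> = (if m + int k \<le> \<tau> \<and> \<tau> < m + int k + int n - int d then R
     else if m + int n + int d + 1 - int k \<le> \<tau> \<and> \<tau> \<le> m + 2 * int n - int k then L else P)"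
    if "m < \<tau>" "\<tau> < m + 2 * int n" for \<tau>
    unfolding f_def letter_after[OF j that] using k d d_le by (auto simp: of_nat_diff)
  have before: "f \<tau> = (if m - 2 * int n + int k \<le> \<tau> \<and> \<tau> < m + int k - int n - int d then L
     else if m - int n + int d + 1 - int k \<le> \<tau> \<and> \<tau> \<le> m - int k then R else P)"
    if "m - 2 * int n < \<tau>" "\<tau> < m" for \<tau>
    unfolding f_def letter_before[OF j that] using k d d_le by (auto simp: of_nat_diff)
  have path: "path A \<pi> (E m (d + 1 - k)) = map f [1..2 * int n]"
    by (simp add: path_def f_def card_A)
  note rules = map_run map_point map_last_run
  consider "\<delta> = 0" "2 \<le> k" | "\<not> (\<delta> = 0 \<and> 2 \<le> k)" "int d - int k < int n - int \<delta>"
    | "\<not> (\<delta> = 0 \<and> 2 \<le> k)" "int d - int k \<ge> \<bar>int \<delta> - int n\<bar>"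
    | "int d - int k < int \<delta> - int n" by linarith
  then show ?thesis
  proof cases
    case 1
    have "map f [1..2 * int n] =
      [C] @ P\<up>(k - 1) @ R\<up>(n - d) @ P\<up>(2 * (d - k) + 1) @ L\<up>(n - d) @ P\<up>(k - 1)"
      by (intro rules; use 1 m k \<delta> d_le at after before in \<open>simp add: of_nat_diff\<close>)
    then show ?thesis using 1 path by simp
  next
    case 2
    have "k \<le> \<delta> + 1" using 2(1) \<delta>(1) k by auto
    then have "map f [1..2 * int n] =
        R\<up>(\<delta> + 1 - k) @ P\<up>(k - 1) @ [C] @ P\<up>(k - 1) @ R\<up>(n - d)
             @ P\<up>(2 * (d - k) + 1) @ L\<up>(n + k - (d + \<delta> + 1))"
      by (intro rules; use 2 m k \<delta> d_le at after before in \<open>simp add: of_nat_diff\<close>)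
    then show ?thesis unfolding path if_not_P[OF 2(1)] if_P[OF 2(2)] .
  next
    case 3
    have near: "int n - int \<delta> \<le> int d - int k" "int \<delta> - int n \<le> int d - int k"
      using 3(2) by linarith+
    have "map f [1..2 * int n] =
        P\<up>(d + \<delta> + 1 - (k + n)) @ R\<up>(n - d) @ P\<up>(k - 1) @ [C] @ P\<up>(k - 1)
             @ R\<up>(n - d) @ P\<up>(d + n - (k + \<delta>))"
      by (intro rules; use 3(1) near m k \<delta> d_le at after before in \<open>simp add: of_nat_diff\<close>)
    moreover have "\<not> int d - int k < int n - int \<delta>" using near by linarith
    ultimately show ?thesis unfolding path if_not_P[OF 3(1)] using 3(2) by simp
  next
    case 4
    have "map f [1..2 * int n] =
        L\<up>(\<delta> + k - (n + d)) @ P\<up>(2 * (d - k) + 1) @ R\<up>(n - d) @ P\<up>(k - 1)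
             @ [C] @ P\<up>(k - 1) @ R\<up>(2 * n - (\<delta> + k))"
      by (intro rules; use 4 m k \<delta> d_le at after before in \<open>simp add: of_nat_diff\<close>)
    then show ?thesis using 4 path k d_le by simp
  qed
qed

lemma crossing_substring_at_D:
  assumes "0 < D m"
  shows "length (crossing_substring_at A \<pi> m) = 2 * D m"
    and "\<And>k. 1 \<le> k \<Longrightarrow> k \<le> D m \<Longrightarrow> crossing_substring_at A \<pi> m ! (k - 1) = E m (D m + 1 - k)"
proof -
  obtain I where I: "crossing_switch A \<pi> m I" using assms D_pos_iff by blast
  have "(THE I. crossing_switch A \<pi> m I) = (n + 1 - D m, n + D m)"
  proof (rule the_equality)
    show "crossing_switch A \<pi> m (n + 1 - D m, n + D m)"
      using I crossing_switch_central(1)[OF I] by simp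
  qed (rule crossing_switch_central(1))
  then have eq: "crossing_substring_at A \<pi> m =
      map (inv_into A (\<pi> (m - 1))) [n + 1 - D m..<Suc (n + D m)]"
    by (simp add: crossing_substring_at_def)
  then show "length (crossing_substring_at A \<pi> m) = 2 * D m"
    using D_le[of m] by (simp del: upt_Suc)
  fix k assume k: "1 \<le> k" "k \<le> D m"
  then have j: "D m + 1 - k \<in> {1..D m}" by auto
  have pos: "\<pi> (m - 1) (E m (D m + 1 - k)) = n + 1 - D m + (k - 1)"
    using E_position_before[OF j] k D_le[of m] by linarith
  have "crossing_substring_at A \<pi> m ! (k - 1) = inv_into A (\<pi> (m - 1)) (n + 1 - D m + (k - 1))"
    unfolding eq using k D_le[of m] by (simp del: upt_Suc)
  also have "\<dots> = E m (D m + 1 - k)"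
    unfolding pos[symmetric]
    by (rule inv_into_f_f[OF bij_betw_imp_inj_on[OF bij] E_in[OF j]])
  finally show "crossing_substring_at A \<pi> m ! (k - 1) = E m (D m + 1 - k)" .
qed

lemma crossing_moves_D: "crossing_moves A \<pi> (2 * n) = sorted_list_of_set {i \<in> {1..2 * int n}. 0 < D i}"
  unfolding crossing_moves_def D_pos_iff by (rule arg_cong[of _ _ sorted_list_of_set]) auto

end

theorem corollary3p2:
  fixes A :: "'a set" and \<pi> :: "int \<Rightarrow> 'a \<Rightarrow> nat"
    and n h t :: nat and d \<delta> :: "nat \<Rightarrow> nat"
  assumes "2 \<le> t"
    and "card A = 2 * n"
    and "allowable_sequence A \<pi> h"
    and "even_near_critical A h"
    and "centrally_symmetric A \<pi>"
    and "noncentral_general_position A \<pi>"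
    and "central_signature A \<pi> h = map d [1..<Suc t]"
    and "\<exists>I. crossing_switch A \<pi> 1 I"
    and "\<delta> 1 = 0"
    and "\<delta> 2 = d 1 + d 2"
    and "\<forall>i. 3 \<le> i \<and> i \<le> t \<longrightarrow> \<delta> i = d 1 + (\<Sum>j = 2..i - 1. 2 * d j) + d i"
  shows "\<forall>i. 1 \<le> i \<and> i \<le> t \<longrightarrow>
    crossing_moves A \<pi> h ! (i - 1) = int (\<delta> i) + 1 \<and>
    (\<forall>k. 1 \<le> k \<and> k \<le> d i \<longrightarrow>
      path A \<pi> (crossing_point A \<pi> h i k) =
        (if i = 1 \<and> 2 \<le> k then
           [C] @ P\<up>(k - 1) @ R\<up>(n - d i) @ P\<up>(2 * (d i - k) + 1) @ L\<up>(n - d i) @ P\<up>(k - 1)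
         else if int (d i) - int k < int n - int (\<delta> i) then
           R\<up>(\<delta> i + 1 - k) @ P\<up>(k - 1) @ [C] @ P\<up>(k - 1) @ R\<up>(n - d i)
             @ P\<up>(2 * (d i - k) + 1) @ L\<up>(n + k - (d i + \<delta> i + 1))
         else if int (d i) - int k \<ge> \<bar>int (\<delta> i) - int n\<bar> then
           P\<up>(d i + \<delta> i + 1 - (k + n)) @ R\<up>(n - d i) @ P\<up>(k - 1) @ [C] @ P\<up>(k - 1)
             @ R\<up>(n - d i) @ P\<up>(d i + n - (k + \<delta> i))
         else
           L\<up>(\<delta> i + k - (n + d i)) @ P\<up>(2 * (d i - k) + 1) @ R\<up>(n - d i) @ P\<up>(k - 1)
             @ [C] @ P\<up>(k - 1) @ R\<up>(2 * n - (\<delta> i + k))))"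
proof -
  have h: "h = 2 * n" using assms(2,4) by (simp add: even_near_critical_def)
  interpret symmetric_sequence A \<pi> n
    using assms(2,3,5,6) h by unfold_locales simp_all
  define M where "M = {i \<in> {1..2 * int n}. 0 < D i}"
  define ms where "ms = crossing_moves A \<pi> h"
  have finM: "finite M" by (rule finite_subset[of _ "{1..2 * int n}"]) (auto simp: M_def)
  have ms: "ms = sorted_list_of_set M" by (simp add: ms_def M_def h crossing_moves_D)
  have set_ms: "set ms = M" by (simp add: ms finM)
  have substrings: "crossing_substrings A \<pi> h = map (crossing_substring_at A \<pi>) ms"
    by (simp add: crossing_substrings_def ms_def)
  have len: "length ms = t"
    using arg_cong[OF assms(7), of length] by (simp add: central_signature_def substrings)
  have mono: "ms ! x < ms ! y" if "x < y" "y < t" for x y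
    using sorted_wrt_nth_less[of "(<)" ms x y] that len by (simp add: ms)
  have in_M: "ms ! x \<in> M" if "x < t" for x using that len set_ms nth_mem by blast
  have d: "d i = D (ms ! (i - 1))" if "1 \<le> i" "i \<le> t" for i
  proof -
    have "d i = map d [1..<Suc t] ! (i - 1)" using that by (simp del: upt_Suc)
    also have "\<dots> = central_signature A \<pi> h ! (i - 1)" by (simp only: assms(7))
    also have "\<dots> = length (crossing_substring_at A \<pi> (ms ! (i - 1))) div 2"
      using that len by (simp add: central_signature_def substrings)
    also have "\<dots> = D (ms ! (i - 1))"
      using crossing_substring_at_D(1)[of "ms ! (i - 1)"] in_M[of "i - 1"] that by (simp add: M_def)
    finally show ?thesis .
  qed
  have "0 < D 1" using assms(8) D_pos_iff by blast
  then have "1 \<in> set ms" unfolding set_ms using n_pos by (simp add: M_def)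
  then obtain x where x: "x < t" "ms ! x = 1" using len by (auto simp: in_set_conv_nth)
  \<comment> \<open>so the gaps between the first and the other crossing moves determine all crossing moves\<close>
  have first: "ms ! 0 = 1"
    using x mono[of 0 x] in_M[of 0] by (cases "x = 0") (auto simp: M_def)
  have S: "S 1 (ms ! (i - 1)) = (\<Sum>j = 2..i - 1. d j)" if i: "2 \<le> i" "i \<le> t" for i
  proof -
    have image: "(\<lambda>j. ms ! (j - 1)) ` {2..i - 1} = {l \<in> {1<..<ms ! (i - 1)}. 0 < D l}"
    proof (intro equalityI subsetI)
      fix l assume "l \<in> (\<lambda>j. ms ! (j - 1)) ` {2..i - 1}"
      then obtain j where j: "2 \<le> j" "j \<le> i - 1" "l = ms ! (j - 1)" by auto
      then show "l \<in> {l \<in> {1<..<ms ! (i - 1)}. 0 < D l}"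
        using mono[of 0 "j - 1"] mono[of "j - 1" "i - 1"] in_M[of "j - 1"] i first
        by (auto simp: M_def)
    next
      fix l assume l: "l \<in> {l \<in> {1<..<ms ! (i - 1)}. 0 < D l}"
      then have "l \<in> set ms" using in_M[of "i - 1"] i by (fastforce simp: set_ms M_def)
      then obtain x where x: "x < t" "ms ! x = l" using len by (auto simp: in_set_conv_nth)
      have "x \<noteq> 0" using x l first by (cases "x = 0") auto
      moreover have "x < i - 1"
        using mono[of "i - 1" x] x l by (cases x "i - 1" rule: linorder_cases) auto
      ultimately show "l \<in> (\<lambda>j. ms ! (j - 1)) ` {2..i - 1}"
        using x by (intro image_eqI[of _ _ "x + 1"]) auto
    qed
    have inj: "inj_on (\<lambda>j. ms ! (j - 1)) {2..i - 1}"
    proof (rule linorder_inj_onI)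
      fix a b assume "a < b" "a \<in> {2..i - 1}" "b \<in> {2..i - 1}"
      then have "ms ! (a - 1) < ms ! (b - 1)" using mono[of "a - 1" "b - 1"] i by auto
      then show "ms ! (a - 1) \<noteq> ms ! (b - 1)" by simp
    qed auto
    have "S 1 (ms ! (i - 1)) = sum D {l \<in> {1<..<ms ! (i - 1)}. 0 < D l}"
      unfolding S_def by (rule sum.mono_neutral_right) auto
    also have "\<dots> = (\<Sum>j = 2..i - 1. D (ms ! (j - 1)))"
      unfolding image[symmetric] sum.reindex[OF inj] by simp
    also have "\<dots> = (\<Sum>j = 2..i - 1. d j)"
      using d i by (intro sum.cong) auto
    finally show ?thesis .
  qed
  have gap1: "ms ! (i - 1) - 1 = int (\<delta> i)" if i: "2 \<le> i" "i \<le> t" for i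
  proof -
    have less: "1 < ms ! (i - 1)" using mono[of 0 "i - 1"] i first by simp
    have "ms ! (i - 1) \<in> M" using in_M[of "i - 1"] i by auto
    then have M: "ms ! (i - 1) < 1 + 2 * int n" "0 < D (ms ! (i - 1))"
      unfolding M_def by auto
    have "ms ! (i - 1) - 1 = int (d 1 + 2 * (\<Sum>j = 2..i - 1. d j) + d i)"
      using gap[OF less _ \<open>0 < D 1\<close>] M S[OF i] d[of 1] d[of i] first i by simp
    also have "d 1 + 2 * (\<Sum>j = 2..i - 1. d j) + d i = \<delta> i"
      using assms(10,11) i by (cases "i = 2") (auto simp: sum_distrib_left)
    finally show ?thesis .
  qed
  show ?thesis
  proof (intro allI impI conjI)
    fix i assume i: "1 \<le> i \<and> i \<le> t"
    show m: "crossing_moves A \<pi> h ! (i - 1) = int (\<delta> i) + 1"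
      using gap1[of i] i first assms(9) unfolding ms_def[symmetric] by (cases "i = 1") auto
    fix k assume k: "1 \<le> k \<and> k \<le> d i"
    let ?m = "ms ! (i - 1)"
    have mi: "?m = int (\<delta> i) + 1" using m by (simp add: ms_def)
    have M: "?m \<in> M" using in_M[of "i - 1"] i by auto
    have di: "d i = D ?m" using d i by blast
    have point: "crossing_point A \<pi> h i k = E ?m (d i + 1 - k)"
      unfolding crossing_point_def substrings
      using crossing_substring_at_D(2)[of ?m k] M k i len di by (auto simp: M_def)
    have later: "1 < ?m" if "i \<noteq> 1"
    proof -
      have "0 < i - 1" "i - 1 < t" using that i by auto
      from mono[OF this] show ?thesis by (simp only: first)
    qed
    have zero: "\<delta> i = 0 \<longleftrightarrow> i = 1"
      using assms(9) later mi by (cases "i = 1") auto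
    \<comment> \<open>gaps to the first crossing move of this halfperiod and of the next one\<close>
    have "\<delta> i + d i \<le> 2 * n \<and> (\<delta> i = 0 \<or> d i \<le> \<delta> i)"
    proof (cases "i = 1")
      case True
      then show ?thesis using assms(9) di D_le[of ?m] by simp
    next
      case False
      have range: "1 < ?m" "?m < 1 + 2 * int n" "0 < D ?m" using later[OF False] M by (auto simp: M_def)
      have "?m - 1 = int (D 1 + 2 * S 1 ?m + D ?m)"
        using range \<open>0 < D 1\<close> by (intro gap) auto
      moreover have "1 + 2 * int n - ?m = int (D ?m + 2 * S ?m (1 + 2 * int n) + D (1 + 2 * int n))"
        using range \<open>0 < D 1\<close> by (intro gap) (auto simp: D_periodic)
      moreover have "D (1 + 2 * int n) = D 1" by (rule D_periodic)
      ultimately show ?thesis using mi di \<open>0 < D 1\<close> by linarith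
    qed
    then show "path A \<pi> (crossing_point A \<pi> h i k) =
        (if i = 1 \<and> 2 \<le> k then
           [C] @ P\<up>(k - 1) @ R\<up>(n - d i) @ P\<up>(2 * (d i - k) + 1) @ L\<up>(n - d i) @ P\<up>(k - 1)
         else if int (d i) - int k < int n - int (\<delta> i) then
           R\<up>(\<delta> i + 1 - k) @ P\<up>(k - 1) @ [C] @ P\<up>(k - 1) @ R\<up>(n - d i)
             @ P\<up>(2 * (d i - k) + 1) @ L\<up>(n + k - (d i + \<delta> i + 1))
         else if int (d i) - int k \<ge> \<bar>int (\<delta> i) - int n\<bar> then
           P\<up>(d i + \<delta> i + 1 - (k + n)) @ R\<up>(n - d i) @ P\<up>(k - 1) @ [C] @ P\<up>(k - 1)
             @ R\<up>(n - d i) @ P\<up>(d i + n - (k + \<delta> i))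
         else
           L\<up>(\<delta> i + k - (n + d i)) @ P\<up>(2 * (d i - k) + 1) @ R\<up>(n - d i) @ P\<up>(k - 1)
             @ [C] @ P\<up>(k - 1) @ R\<up>(2 * n - (\<delta> i + k)))"
      unfolding point zero[symmetric] using path_E[OF mi _ _ di] k by blast
  qed
qed

end
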